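(* Let $T$ be an integer, non-singular matrix transformation of the torus $\mathbb{T}^d$. Suppose that $T$ is diagonalizable over $\mathbb{Z}$ with all eigenvalues $\beta_1,\beta_2,\dots,\beta_d$ strictly larger than $1$. Assume that $1<\beta_1\le\beta_2\le\cdots\le\beta_d$. Let $\psi:\mathbb{R}^+\to\mathbb{R}^+$ be a real positive function and let $\mathbf{a}\in\mathbb{T}^d$. Then $$\dim_{\rm H}W(T,\psi,\mathbf{a})=\min_{1\le i\le d}\theta_i(\lambda),$$ where $\lambda=\lambda(\psi)$ is the lower order at infinity of $\psi$ and $$\theta_i(\lambda):=\frac{i\log\beta_i-\sum\limits_{k:\,\beta_k>\beta_ie^\lambda}(\log\beta_k-\log\beta_i-\lambda)+\sum\limits_{k>i}\log\beta_k}{\lambda+\log\beta_i}.$$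
   Context: An integer $d\times d$ matrix $T$ determines a self-map of $\mathbb{T}^d=\mathbb{R}^d/\mathbb{Z}^d$, also denoted $T$, sending $\mathbf{x}$ to $T\mathbf{x}$ modulo one; $T^n$ is its $n$-th iterate. $T$ is diagonalizable over $\mathbb{Z}$ means that there exist a non-singular integer matrix $P$ and a diagonal integer matrix $D$ such that $PT=DP$ and, in turn, an invertible mapping $\phi:\mathbb{T}^d\to\mathbb{T}^d$ such that $\phi\circ T=D\circ\phi$. $\|\cdot\|$ is the distance to the nearest integer. For $\mathbf{a}=(a_1,\dots,a_d)$ let $B(\mathbf{a},\psi(n)):=\{\mathbf{x}\in\mathbb{T}^d:\max_{1\le i\le d}\|x_i-a_i\|\le\psi(n)\}$ and $$W(T,\psi,\mathbf{a}):=\{\mathbf{x}\in\mathbb{T}^d:T^n(\mathbf{x})\in B(\mathbf{a},\psi(n))\text{ for infinitely many }n\in\mathbb{N}\}.$$ Lower order at infinity: $\lambda=\lambda(\psi):=\liminf_{n\to\infty}\frac{-\log\psi(n)}{n}$. If $\lambda=+\infty$, $\theta_i(\lambda)$ is read as its limit as $\lambda\to\infty$, namely $0$. $\dim_{\rm H}$ is Hausdorff dimension.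
   Formalization: The formal theorem assumes additionally λ(ψ) > −log β₁, so that all denominators λ+log β_i are positive; otherwise θ_i may be undefined or the formula false (T = diag(2,4), ψ(n) = e^{2n}: W is the whole torus, but θ₂ ≈ 0.87). It is automatic for bounded ψ. *)

theory Defs
  imports "HOL-Analysis.Analysis" "HOL-Computational_Algebra.Polynomial"
begin

section \<open>The torus\<close>

definition nint_dist :: "real \<Rightarrow> real" where
  "nint_dist x = \<bar>x - of_int (round x)\<bar>"

lemma nint_dist_le: "nint_dist x \<le> \<bar>x - of_int m\<bar>"
  unfolding nint_dist_def by (rule round_diff_minimal)

lemma nint_dist_nonneg: "0 \<le> nint_dist x"
  by (simp add: nint_dist_def)

lemma nint_dist_eq_0_iff: "nint_dist x = 0 \<longleftrightarrow> x \<in> \<int>"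
  by (auto simp: nint_dist_def elim!: Ints_cases) (metis Ints_of_int)

lemma nint_dist_triangle: "nint_dist (x + y) \<le> nint_dist x + nint_dist y"
  using nint_dist_le[of "x + y" "round x + round y"] by (simp add: nint_dist_def)

lemma nint_dist_minus: "nint_dist (- x) = nint_dist x"
proof -
  have le: "nint_dist (- z) \<le> nint_dist z" for z
    using nint_dist_le[of "- z" "- round z"] by (simp add: nint_dist_def)
  show ?thesis
    using le[of x] le[of "- x"] by simp
qed

lemma nint_dist_cong:
  assumes "x - y \<in> \<int>"
  shows "nint_dist x = nint_dist y"
proof -
  have "nint_dist (x - y) = 0" "nint_dist (y - x) = 0"
    using assms nint_dist_minus[of "x - y"] by (auto simp: nint_dist_eq_0_iff)
  then show ?thesis
    using nint_dist_triangle[of "x - y" y] nint_dist_triangle[of "y - x" x] by simp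
qed

definition torus_rel :: "real ^ 'n \<Rightarrow> real ^ 'n \<Rightarrow> bool" where
  "torus_rel x y \<longleftrightarrow> (\<forall>i. x $ i - y $ i \<in> \<int>)"

lemma equivp_torus_rel: "equivp torus_rel"
proof (rule equivpI)
  show "reflp torus_rel"
    by (auto simp: reflp_def torus_rel_def)
  show "symp torus_rel"
    by (auto simp: symp_def torus_rel_def) (metis Ints_minus minus_diff_eq)
  show "transp torus_rel"
  proof (rule transpI)
    fix x y z :: "real ^ 'n"
    assume "torus_rel x y" "torus_rel y z"
    then have "(x $ i - y $ i) + (y $ i - z $ i) \<in> \<int>" for i
      unfolding torus_rel_def by (intro Ints_add) auto
    then show "torus_rel x z"
      by (simp add: torus_rel_def)
  qed
qed

quotient_type 'n torus = "real ^ 'n::finite" / torus_rel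
  by (rule equivp_torus_rel)

text \<open>The metric is the maximum over the coordinates of the distance of \<open>x\<^sub>i - y\<^sub>i\<close> to the nearest
  integer, so that \<open>cball a r\<close> is the closed sup-norm ball around \<open>a\<close>.\<close>

instantiation torus :: (finite) metric_space
begin

lift_definition dist_torus :: "'a torus \<Rightarrow> 'a torus \<Rightarrow> real" is
  "\<lambda>x y. MAX i. nint_dist (x $ i - y $ i)"
proof -
  fix x x' y y' :: "real ^ 'a"
  assume "torus_rel x x'" "torus_rel y y'"
  then have "(x $ i - x' $ i) - (y $ i - y' $ i) \<in> \<int>" for i
    unfolding torus_rel_def by (simp add: Ints_diff[of "x $ i - x' $ i" "y $ i - y' $ i"])
  then have "nint_dist (x $ i - y $ i) = nint_dist (x' $ i - y' $ i)" for i
    by (intro nint_dist_cong) (simp add: algebra_simps)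
  then show "(MAX i. nint_dist (x $ i - y $ i)) = (MAX i. nint_dist (x' $ i - y' $ i))"
    by simp
qed

definition uniformity_torus :: "('a torus \<times> 'a torus) filter" where
  "uniformity_torus = (INF e\<in>{0<..}. principal {(x, y). dist x y < e})"

definition open_torus :: "'a torus set \<Rightarrow> bool" where
  "open_torus U \<longleftrightarrow> (\<forall>x\<in>U. eventually (\<lambda>(x', y). x' = x \<longrightarrow> y \<in> U) uniformity)"

instance
proof
  show "dist x y = 0 \<longleftrightarrow> x = y" for x y :: "'a torus"
  proof (transfer, unfold torus_rel_def)
    fix x y :: "real ^ 'a"
    let ?M = "MAX i. nint_dist (x $ i - y $ i)"
    have *: "0 \<le> nint_dist (x $ i - y $ i) \<and> nint_dist (x $ i - y $ i) \<le> ?M" for i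
      by (simp add: nint_dist_nonneg)
    have **: "?M \<in> range (\<lambda>i. nint_dist (x $ i - y $ i))"
      by (rule Max_in) auto
    have "?M = 0 \<longleftrightarrow> (\<forall>i. nint_dist (x $ i - y $ i) = 0)"
      using * ** by (metis (no_types, lifting) antisym imageE)
    then show "?M = 0 \<longleftrightarrow> (\<forall>i. x $ i - y $ i \<in> \<int>)"
      by (simp add: nint_dist_eq_0_iff)
  qed
  show "dist x y \<le> dist x z + dist y z" for x y z :: "'a torus"
  proof transfer
    fix x y z :: "real ^ 'a"
    have "nint_dist (x $ i - y $ i)
        \<le> (MAX i. nint_dist (x $ i - z $ i)) + (MAX i. nint_dist (y $ i - z $ i))" for i
    proof -
      have "nint_dist (x $ i - y $ i) \<le> nint_dist (x $ i - z $ i) + nint_dist (y $ i - z $ i)"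
        using nint_dist_triangle[of "x $ i - z $ i" "z $ i - y $ i"]
          nint_dist_minus[of "y $ i - z $ i"] by simp
      also have "\<dots> \<le> (MAX i. nint_dist (x $ i - z $ i)) + (MAX i. nint_dist (y $ i - z $ i))"
        by (intro add_mono) auto
      finally show ?thesis .
    qed
    then show "(MAX i. nint_dist (x $ i - y $ i))
        \<le> (MAX i. nint_dist (x $ i - z $ i)) + (MAX i. nint_dist (y $ i - z $ i))"
      by simp
  qed
qed (simp_all only: uniformity_torus_def open_torus_def)

end

lift_definition torus_map :: "int ^ 'n ^ 'n \<Rightarrow> 'n torus \<Rightarrow> 'n torus" is
  "\<lambda>T x. map_matrix real_of_int T *v x"
proof -
  fix T :: "int ^ 'n ^ 'n" and x y :: "real ^ 'n"
  assume "torus_rel x y"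
  then have "(\<Sum>j\<in>UNIV. real_of_int (T $ i $ j) * (x $ j - y $ j)) \<in> \<int>" for i
    unfolding torus_rel_def by (intro Ints_sum Ints_mult) auto
  then show "torus_rel (map_matrix real_of_int T *v x) (map_matrix real_of_int T *v y)"
    by (simp add: torus_rel_def matrix_vector_mult_def sum_subtractf right_diff_distrib)
qed

section \<open>Integer matrices\<close>

definition charpoly :: "'a::comm_ring_1 ^ 'n ^ 'n \<Rightarrow> 'a poly" where
  "charpoly A = det (\<chi> i j. (if i = j then [:0, 1:] else 0) - [:A $ i $ j:])"

text \<open>Non-singular means non-zero determinant, so \<open>P\<close> is invertible over the rationals but need not
  be invertible over the integers.\<close>

definition diagonalizable_over_int :: "int ^ 'n ^ 'n \<Rightarrow> bool" where
  "diagonalizable_over_int T \<longleftrightarrow>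
    (\<exists>P D :: int ^ 'n ^ 'n. det P \<noteq> 0 \<and> (\<forall>i j. i \<noteq> j \<longrightarrow> D $ i $ j = 0) \<and> P ** T = D ** P)"

section \<open>Hausdorff dimension\<close>

text \<open>Boundedness is required because \<open>diameter\<close> is unspecified on unbounded sets. Only exponents
  \<open>s > 0\<close> are meaningful, since \<open>0 powr 0 = 0\<close>; this does not affect the dimension.\<close>

definition hausdorff_premeasure :: "real \<Rightarrow> real \<Rightarrow> 'a::metric_space set \<Rightarrow> ennreal" where
  "hausdorff_premeasure s \<delta> A =
    (INF U \<in> {U :: nat \<Rightarrow> 'a set. A \<subseteq> (\<Union>n. U n) \<and> (\<forall>n. bounded (U n) \<and> diameter (U n) \<le> \<delta>)}.
      \<Sum>n. ennreal (diameter (U n) powr s))"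

definition hausdorff_measure :: "real \<Rightarrow> 'a::metric_space set \<Rightarrow> ennreal" where
  "hausdorff_measure s A = (SUP \<delta>\<in>{0<..}. hausdorff_premeasure s \<delta> A)"

definition hausdorff_dim :: "'a::metric_space set \<Rightarrow> ereal" where
  "hausdorff_dim A = Inf {ereal s | s. 0 < s \<and> hausdorff_measure s A = 0}"

section \<open>Shrinking targets\<close>

definition shrinking_target_set ::
    "int ^ 'n ^ 'n \<Rightarrow> (real \<Rightarrow> real) \<Rightarrow> 'n torus \<Rightarrow> 'n torus set" where
  "shrinking_target_set T \<psi> a = {x. \<exists>\<^sub>\<infinity>n. (torus_map T ^^ n) x \<in> cball a (\<psi> (real n))}"

definition lower_order :: "(real \<Rightarrow> real) \<Rightarrow> ereal" where
  "lower_order \<psi> = liminf (\<lambda>n. ereal (- ln (\<psi> (real n)) / real n))"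

text \<open>The value at \<open>L = \<infinity>\<close> is the limit as \<open>L\<close> tends to infinity.
  Meaningful only for \<open>\<beta> i > 0\<close> and \<open>- ln (\<beta> i) < L\<close>.\<close>

definition theta :: "nat \<Rightarrow> (nat \<Rightarrow> real) \<Rightarrow> ereal \<Rightarrow> nat \<Rightarrow> real" where
  "theta d \<beta> L i =
    (if L = \<infinity> then 0 else
      (let l = real_of_ereal L in
      (real i * ln (\<beta> i)
        - (\<Sum>k | k \<in> {1..d} \<and> \<beta> k > \<beta> i * exp l. ln (\<beta> k) - ln (\<beta> i) - l)
        + (\<Sum>k = i + 1..d. ln (\<beta> k)))
      / (l + ln (\<beta> i))))"

end

theory Submission
  imports Defs
begin

text \<open>
  If \<open>P T = D P\<close>, then in the coordinates \<open>y = P x\<close> the map acts by multiplying each coordinate by an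
  integer eigenvalue. As \<open>P\<close> need not be invertible over the integers, \<open>P\<close> is only used for the upper bound;
  for the lower bound one parametrises by \<open>x = M y\<close>, where \<open>M\<close> is the integral adjugate,
  \<open>P M = M P = det P\<close>. Either substitution keeps lattice points on the lattice and is locally bi-Lipschitz.

  Upper bound: in the \<open>y\<close> coordinates, the points with \<open>T\<^sup>n x\<close> in the \<open>n\<close>-th ball are
  covered by boxes of side \<open>r = \<psi>(n) / \<beta>\<^sub>i\<^sup>n\<close>; coordinate \<open>k\<close> needs about
  \<open>min (1/r) (max \<beta>\<^sub>i\<^sup>n \<beta>\<^sub>k\<^sup>n)\<close> intervals, and multiplying over \<open>k\<close> gives \<open>\<theta>\<^sub>i\<close>.

  Lower bound: along a very sparse sequence of times the target set contains a product of one-dimensional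
  Cantor sets. At scale \<open>r = exp (- t n)\<close>, with \<open>n\<close> the last relevant time, the uniform measure of a box is about
  \<open>exp (- n * (\<Sum>k. max (min (ln \<beta>\<^sub>k) t) (t - \<lambda>)))\<close>. The exponent is piecewise linear in \<open>t\<close>, concave between
  the points \<open>t = ln \<beta>\<^sub>i + \<lambda>\<close>, where its quotient by \<open>t\<close> is \<open>\<theta>\<^sub>i(\<lambda>)\<close>.
  The uniform measures are replaced by counting in finite sets, so that no limit measure is needed.
\<close>

section \<open>Hausdorff measure\<close>

lemma hausdorff_dim_leI:
  assumes "\<And>t. s < t \<Longrightarrow> hausdorff_measure t A = 0" and "0 \<le> s"
  shows "hausdorff_dim A \<le> ereal s"
proof (rule ereal_le_epsilon2)
  fix e :: real assume "0 < e"
  then have "ereal (s + e) \<in> {ereal s | s. 0 < s \<and> hausdorff_measure s A = 0}"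
    using assms by auto
  then show "hausdorff_dim A \<le> ereal s + ereal e"
    unfolding hausdorff_dim_def by (simp add: Inf_lower)
qed

lemma hausdorff_dim_geI:
  assumes "\<And>t. 0 < t \<Longrightarrow> t < s \<Longrightarrow> hausdorff_measure t A \<noteq> 0"
  shows "ereal s \<le> hausdorff_dim A"
  unfolding hausdorff_dim_def
proof (rule Inf_greatest)
  fix z assume "z \<in> {ereal s | s. 0 < s \<and> hausdorff_measure s A = 0}"
  then obtain t where t: "z = ereal t" "0 < t" "hausdorff_measure t A = 0" by blast
  then have "\<not> t < s" using assms by blast
  then show "ereal s \<le> z" using t(1) by simp
qed

lemma hausdorff_dim_nonneg: "0 \<le> hausdorff_dim A"
  unfolding hausdorff_dim_def by (intro Inf_greatest) auto

text \<open>The sets \<open>G n\<close> and the complements of the \<open>K J\<close> form an open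
  cover of the compact set \<open>K 0\<close>. Beyond every index of a complement in a finite
  subcover, \<open>K J\<close> misses all of those complements, so the finitely many
  \<open>G n\<close> must cover it.\<close>

lemma compact_decseq_subset_open:
  fixes K :: "nat \<Rightarrow> 'a::metric_space set"
  assumes K: "\<And>J. compact (K J)" and dec: "decseq K"
    and op: "\<And>n::nat. open (G n)" and sub: "(\<Inter>J. K J) \<subseteq> (\<Union>n. G n)"
  shows "\<exists>I. finite I \<and> (\<forall>\<^sub>F J in sequentially. K J \<subseteq> (\<Union>n\<in>I. G n))"
proof -
  let ?H = "\<lambda>i. case i of Inl n \<Rightarrow> G n | Inr J \<Rightarrow> - K J"
  have opH: "open (?H i)" for i
  proof (cases i)
    case (Inl n)
    then show ?thesis using op by simp
  next
    case (Inr J)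
    then show ?thesis using compact_imp_closed[OF K] by (simp add: open_Compl)
  qed
  have covH: "K 0 \<subseteq> (\<Union>i\<in>UNIV. ?H i)"
  proof
    fix x assume "x \<in> K 0"
    have 1: "x \<in> G n \<Longrightarrow> x \<in> (\<Union>i\<in>UNIV. ?H i)" for n
      by (rule UN_I[of "Inl n"]) simp_all
    have 2: "x \<notin> K J \<Longrightarrow> x \<in> (\<Union>i\<in>UNIV. ?H i)" for J
      by (rule UN_I[of "Inr J"]) simp_all
    show "x \<in> (\<Union>i\<in>UNIV. ?H i)"
    proof (cases "\<exists>J. x \<notin> K J")
      case True
      then show ?thesis using 2 by (elim exE)
    next
      case False
      then have "x \<in> (\<Union>n. G n)" using sub by (intro subsetD[OF sub] INT_I) simp
      then obtain n where "x \<in> G n" by (elim UN_E)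
      then show ?thesis by (rule 1)
    qed
  qed
  obtain D where D: "finite D" "K 0 \<subseteq> (\<Union>i\<in>D. ?H i)"
    by (rule compactE_image[where S = "K 0" and C = UNIV and f = ?H, OF K opH covH])
  define I where "I = Inl -` D"
  define M where "M = Inr -` D"
  have "finite I" "finite M"
    unfolding I_def M_def by (rule finite_vimageI[OF D(1)], simp)+
  \<comment> \<open>Inserting 0 keeps \<open>Max\<close> meaningful when no complement occurs in the
    subcover.\<close>
  have "K J \<subseteq> (\<Union>n\<in>I. G n)" if J: "J \<ge> Max (insert 0 M)" for J
  proof
    fix x assume x: "x \<in> K J"
    have KJ: "K J \<subseteq> K J'" if "J' \<le> J" for J' using dec that by (simp add: decseq_def)
    obtain i where i: "i \<in> D" "x \<in> ?H i" using subsetD[OF D(2) subsetD[OF KJ[OF le0] x]] by (elim UN_E)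
    show "x \<in> (\<Union>n\<in>I. G n)"
    proof (cases i)
      case (Inl n)
      then show ?thesis using i by (auto simp: I_def)
    next
      case (Inr J')
      then have "J' \<in> M" using i by (simp add: M_def)
      then have "J' \<le> J" using \<open>finite M\<close> J by simp
      then show ?thesis using KJ[of J'] x i(2) Inr by auto
    qed
  qed
  then have "\<forall>\<^sub>F J in sequentially. K J \<subseteq> (\<Union>n\<in>I. G n)"
    unfolding eventually_sequentially by blast
  with \<open>finite I\<close> show ?thesis by blast
qed

text \<open>A mass distribution principle in which the normalised counting measures on
  \<open>F J\<close> stand in for a measure on the limit set. Since \<open>F J\<close> need not lie
  in the intersection, a cover of the image is enlarged to open sets; finitely many preimages then
  cover \<open>K J\<close> for large \<open>J\<close>, and counting the points of \<open>F J\<close>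
  bounds the \<open>s\<close>-sum from below.\<close>

lemma mass_distribution_counting:
  fixes K :: "nat \<Rightarrow> 'a::metric_space set" and \<Phi> :: "'a \<Rightarrow> 'b::metric_space"
  assumes K: "\<And>J. compact (K J)" and dec: "decseq K" and cont: "continuous_on (K 0) \<Phi>"
    and F: "\<And>J. finite (F J)" "\<And>J. F J \<noteq> {}" "\<And>J. F J \<subseteq> K J"
    and pos: "0 < s" "0 < r0" "0 < C"
    and count: "\<And>U r. 0 < r \<Longrightarrow> r < r0 \<Longrightarrow> (\<And>x y. x \<in> U \<Longrightarrow> y \<in> U \<Longrightarrow> dist x y \<le> r) \<Longrightarrow>
      \<forall>\<^sub>F J in sequentially. real (card {y \<in> F J. \<Phi> y \<in> U}) \<le> C * r powr s * real (card (F J))"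
  shows "hausdorff_measure s (\<Phi> ` (\<Inter>J. K J)) \<noteq> 0"
proof
  assume H0: "hausdorff_measure s (\<Phi> ` (\<Inter>J. K J)) = 0"
  \<comment> \<open>The first bound makes the final estimate read \<open>1 < 3/4\<close>; the second
    keeps the enlarged diameters below \<open>r0\<close>, because \<open>r n powr s\<close> stays
    below \<open>2 * \<eta>\<close>.\<close>
  define \<eta> where "\<eta> = min (1 / (4 * C)) (r0 powr s / 4)"
  have \<eta>: "0 < \<eta>" "\<eta> \<le> 1 / (4 * C)" "\<eta> \<le> r0 powr s / 4"
    using pos by (auto simp: \<eta>_def)
  have "hausdorff_premeasure s 1 (\<Phi> ` (\<Inter>J. K J)) \<le> hausdorff_measure s (\<Phi> ` (\<Inter>J. K J))"
    unfolding hausdorff_measure_def by (rule SUP_upper) simp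
  with H0 \<eta>(1) have "hausdorff_premeasure s 1 (\<Phi> ` (\<Inter>J. K J)) < ennreal \<eta>"
    by simp
  then obtain U :: "nat \<Rightarrow> 'b set" where U: "\<Phi> ` (\<Inter>J. K J) \<subseteq> (\<Union>n. U n)" "\<And>n. bounded (U n)"
    "(\<Sum>n. ennreal (diameter (U n) powr s)) < ennreal \<eta>"
    unfolding hausdorff_premeasure_def INF_less_iff by blast
  define d where "d n = diameter (U n)" for n
  \<comment> \<open>The summable extra term makes \<open>r n\<close> exceed the diameter, even when
    that is zero, at a total cost of at most \<open>2 * \<eta>\<close>.\<close>
  define r where "r n = (d n powr s + \<eta> * (1/2) ^ n) powr (1/s)" for n
  have d0: "0 \<le> d n" for n unfolding d_def by (rule diameter_ge_0[OF U(2)])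
  have rs: "r n powr s = d n powr s + \<eta> * (1/2) ^ n" for n
    using \<eta> pos unfolding r_def by (simp add: powr_powr add_nonneg_pos)
  have d_sum: "(\<Sum>n\<in>I. d n powr s) < \<eta>" if "finite I" for I
  proof -
    have "ennreal (\<Sum>n\<in>I. d n powr s) = (\<Sum>n\<in>I. ennreal (d n powr s))"
      by (simp add: sum_ennreal)
    also have "\<dots> \<le> (\<Sum>n. ennreal (d n powr s))"
      by (rule sum_le_suminf) (auto simp: that)
    also have "\<dots> < ennreal \<eta>" using U(3) by (simp add: d_def)
    finally show ?thesis by (simp add: sum_nonneg ennreal_less_iff)
  qed
  have rd: "d n < r n" for n
  proof (rule ccontr)
    assume "\<not> d n < r n"
    then have "r n powr s \<le> d n powr s" using pos by (intro powr_mono2) (auto simp: r_def)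
    moreover have "\<eta> * (1/2) ^ n > 0" using \<eta>(1) by simp
    ultimately show False using rs[of n] by linarith
  qed
  have r0: "r n < r0" for n
  proof (rule ccontr)
    assume "\<not> r n < r0"
    then have "r0 powr s \<le> r n powr s" using pos by (intro powr_mono2) auto
    moreover have "\<eta> * (1/2) ^ n \<le> \<eta>"
      using \<eta>(1) by (simp add: power_le_one)
    moreover have "d n powr s < \<eta>" using d_sum[of "{n}"] by simp
    ultimately show False using rs[of n] \<eta>(1,3) by linarith
  qed
  \<comment> \<open>Enlarging by half the gap on each side keeps distances inside \<open>V n\<close>
    at most \<open>r n\<close>.\<close>
  define V where "V n = (\<Union>u\<in>U n. ball u ((r n - d n) / 2))" for n
  have Vopen: "open (V n)" for n unfolding V_def by auto
  have UV: "U n \<subseteq> V n" for n unfolding V_def using rd[of n] by force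
  have Vdist: "dist x y \<le> r n" if "x \<in> V n" "y \<in> V n" for x y n
  proof -
    obtain u v where uv: "u \<in> U n" "v \<in> U n" "dist u x < (r n - d n) / 2" "dist v y < (r n - d n) / 2"
      using \<open>x \<in> V n\<close> \<open>y \<in> V n\<close> unfolding V_def by auto
    have "dist x y \<le> dist u x + dist u v + dist v y"
      using dist_triangle[of x y u] dist_triangle[of u y v] by (simp add: dist_commute)
    moreover have "dist u v \<le> d n"
      unfolding d_def by (rule diameter_bounded_bound[OF U(2) uv(1,2)])
    ultimately show ?thesis using uv(3,4) unfolding less_divide_eq_numeral1 by linarith
  qed
  \<comment> \<open>Continuity on \<open>K 0\<close> only makes preimages relatively open;
    \<open>G n\<close> is an open set with the same trace on \<open>K 0\<close>.\<close>
  have "\<exists>G. open G \<and> G \<inter> K 0 = \<Phi> -` V n \<inter> K 0" for n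
    using cont[unfolded continuous_on_open_invariant] Vopen by blast
  then obtain G where G: "\<And>n. open (G n)" "\<And>n. G n \<inter> K 0 = \<Phi> -` V n \<inter> K 0"
    by metis
  have "(\<Inter>J. K J) \<subseteq> (\<Union>n. G n)"
  proof
    fix x assume x: "x \<in> (\<Inter>J. K J)"
    then obtain n where "\<Phi> x \<in> V n" using U(1) UV by blast
    then have "x \<in> G n" using x G(2)[of n] by blast
    then show "x \<in> (\<Union>n. G n)" by blast
  qed
  from compact_decseq_subset_open[OF K dec G(1) this]
  obtain I where I: "finite I" "\<forall>\<^sub>F J in sequentially. K J \<subseteq> (\<Union>n\<in>I. G n)"
    by blast
  have "\<forall>\<^sub>F J in sequentially. \<forall>n\<in>I.
      real (card {y \<in> F J. \<Phi> y \<in> V n}) \<le> C * r n powr s * real (card (F J))"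
    using le_less_trans[OF d0 rd] r0 Vdist by (intro eventually_ball_finite[OF I(1)] ballI count)
  from eventually_happens'[OF sequentially_bot eventually_conj[OF I(2) this]]
  obtain J where J: "K J \<subseteq> (\<Union>n\<in>I. G n)"
    "\<And>n. n \<in> I \<Longrightarrow> real (card {y \<in> F J. \<Phi> y \<in> V n}) \<le> C * r n powr s * real (card (F J))"
    by blast
  have KJ: "K J \<subseteq> K 0" using dec by (auto simp: decseq_def)
  have "F J \<subseteq> (\<Union>n\<in>I. {y \<in> F J. \<Phi> y \<in> V n})"
  proof
    fix y assume y: "y \<in> F J"
    then obtain n where "n \<in> I" "y \<in> G n" "y \<in> K 0" using J(1) F(3) KJ by blast
    then show "y \<in> (\<Union>n\<in>I. {y \<in> F J. \<Phi> y \<in> V n})" using G(2)[of n] y by blast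
  qed
  then have "card (F J) \<le> card (\<Union>n\<in>I. {y \<in> F J. \<Phi> y \<in> V n})"
    using I(1) F(1) by (intro card_mono) auto
  also have "\<dots> \<le> (\<Sum>n\<in>I. card {y \<in> F J. \<Phi> y \<in> V n})"
    by (rule card_UN_le[OF I(1)])
  finally have "real (card (F J)) \<le> (\<Sum>n\<in>I. real (card {y \<in> F J. \<Phi> y \<in> V n}))"
    by (metis of_nat_le_iff of_nat_sum)
  also have "\<dots> \<le> (\<Sum>n\<in>I. C * r n powr s * real (card (F J)))"
    using J(2) by (intro sum_mono) auto
  also have "\<dots> = (C * (\<Sum>n\<in>I. r n powr s)) * real (card (F J))"
    by (simp add: sum_distrib_left sum_distrib_right mult_ac)
  finally have "1 \<le> C * (\<Sum>n\<in>I. r n powr s)"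
    using F(1,2)[of J] card_gt_0_iff[of "F J"] by (simp add: mult_le_cancel_right1)
  moreover have "(\<Sum>n\<in>I. r n powr s) < 3 * \<eta>"
  proof -
    have "(\<Sum>n\<in>I. (1/2::real) ^ n) \<le> (\<Sum>n. (1/2) ^ n)"
      by (rule sum_le_suminf) (auto simp: I(1) summable_geometric)
    also have "\<dots> = 2" by (subst suminf_geometric) auto
    finally have "\<eta> * (\<Sum>n\<in>I. (1/2::real) ^ n) \<le> \<eta> * 2" using \<eta>(1) by simp
    then show ?thesis
      using d_sum[OF I(1)] by (simp add: rs sum.distrib sum_distrib_left)
  qed
  ultimately have "1 < C * (3 * \<eta>)"
    using pos by (meson le_less_trans mult_strict_left_mono)
  also have "\<dots> \<le> C * (3 * (1 / (4 * C)))" using \<eta> pos by (intro mult_left_mono) auto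
  finally show False using pos by simp
qed

text \<open>The Borel-Cantelli argument: for every \<open>N\<close> the families
  \<open>\<C> n\<close> with \<open>n \<ge> N\<close> cover the limsup set, and their
  \<open>s\<close>-sums are bounded by a tail of a convergent series.\<close>

lemma hausdorff_measure_limsup_eq_0:
  fixes V :: "nat \<Rightarrow> 'a::metric_space set"
  assumes "0 < s" and A: "A \<subseteq> {x. \<exists>\<^sub>\<infinity>n. x \<in> V n}"
    and fin: "\<And>n. finite (\<C> n)" and cov: "\<And>n. V n \<subseteq> \<Union> (\<C> n)"
    and small: "\<And>n U x y. U \<in> \<C> n \<Longrightarrow> x \<in> U \<Longrightarrow> y \<in> U \<Longrightarrow> dist x y \<le> \<delta> n"
    and \<delta>: "\<delta> \<longlonglongrightarrow> 0" "\<And>n. 0 \<le> \<delta> n"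
    and g: "\<And>n. real (card (\<C> n)) * \<delta> n powr s \<le> g n" "summable g"
  shows "hausdorff_measure s A = 0"
proof -
  have diam: "bounded U \<and> 0 \<le> diameter U \<and> diameter U \<le> \<delta> n" if "U \<in> \<C> n" for U n
  proof (cases "U = {}")
    case False
    then obtain x where "x \<in> U" by blast
    then have b: "bounded U" using small[OF that] by (auto simp: bounded_def)
    have "diameter U \<le> \<delta> n"
      using small[OF that] False by (auto simp: diameter_def intro!: cSUP_least)
    then show ?thesis using b diameter_ge_0[OF b] by simp
  qed (use \<delta>(2) in \<open>auto simp: diameter_empty\<close>)
  have g0: "0 \<le> g n" for n
    using g(1)[of n] by (smt (verit) mult_nonneg_nonneg of_nat_0_le_iff powr_ge_zero)
  have "hausdorff_premeasure s \<epsilon> A = 0" if "0 < \<epsilon>" for \<epsilon>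
  proof -
    have *: "hausdorff_premeasure s \<epsilon> A \<le> 0 + ennreal e" if "0 < e" for e
    proof -
      have ev1: "\<forall>\<^sub>F n in sequentially. \<delta> n < \<epsilon>"
        using \<delta>(1) \<open>0 < \<epsilon>\<close> by (rule order_tendstoD)
      have ev2: "\<forall>\<^sub>F N in sequentially. (\<Sum>n. g (n + N)) < e"
        using order_tendstoD(2)[OF suminf_exist_split2[OF g(2)] \<open>0 < e\<close>] .
      from eventually_happens'[OF sequentially_bot
          eventually_conj[OF eventually_all_ge_at_top[OF ev1] ev2]]
      obtain N where N: "\<And>n. n \<ge> N \<Longrightarrow> \<delta> n < \<epsilon>" "(\<Sum>n. g (n + N)) < e"
        by blast
      have "\<exists>h. \<C> n = h ` {..<card (\<C> n)} \<and> inj_on h {..<card (\<C> n)}" for n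
        using ex_bij_betw_nat_finite[OF fin[of n]] unfolding bij_betw_def atLeast0LessThan by metis
      then obtain h where h: "\<And>n. \<C> n = h n ` {..<card (\<C> n)}" by metis
      \<comment> \<open>All families of the tail become one sequence by coding pairs of a family and
        a member. Surplus indices give the empty set, which contributes
        \<open>0 powr s = 0\<close>.\<close>
      define U where "U m = (case prod_decode m of (n, i) \<Rightarrow>
        if i < card (\<C> (n + N)) then h (n + N) i else {})" for m
      have hC: "h n i \<in> \<C> n" if "i < card (\<C> n)" for n i
        using h[of n] that by blast
      have "A \<subseteq> (\<Union>m. U m)"
      proof
        fix x assume "x \<in> A"
        then have "\<exists>\<^sub>\<infinity>n. x \<in> V n" using A by auto
        then obtain n where "n \<ge> N" "x \<in> V n" by (auto simp: INFM_nat_le)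
        then obtain k where n: "n = k + N" by (metis add.commute le_Suc_ex)
        obtain X where "X \<in> \<C> n" "x \<in> X" using cov[of n] \<open>x \<in> V n\<close> by auto
        then obtain i where "i < card (\<C> n)" "x \<in> h n i" using h[of n] by blast
        then have "x \<in> U (prod_encode (k, i))" by (simp add: U_def n)
        then show "x \<in> (\<Union>m. U m)" by blast
      qed
      moreover have "bounded (U m) \<and> diameter (U m) \<le> \<epsilon>" for m
      proof -
        obtain n i where ni: "prod_decode m = (n, i)" by fastforce
        show ?thesis
        proof (cases "i < card (\<C> (n + N))")
          case True
          then show ?thesis
            using diam[OF hC[OF True]] N(1)[of "n + N"] by (simp add: U_def ni)
        next
          case False
          then show ?thesis using \<open>0 < \<epsilon>\<close> by (simp add: U_def ni)
        qed
      qed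
      ultimately have "hausdorff_premeasure s \<epsilon> A \<le> (\<Sum>m. ennreal (diameter (U m) powr s))"
        unfolding hausdorff_premeasure_def by (intro INF_lower) auto
      also have "\<dots> = (\<Sum>n. \<Sum>i. ennreal (diameter (U (prod_encode (n, i))) powr s))"
        by (subst suminf_ennreal_2dimen[of "\<lambda>n. \<Sum>i. ennreal (diameter (U (prod_encode (n, i))) powr s)"
            "\<lambda>p. ennreal (diameter (U (prod_encode p)) powr s)", symmetric]) (simp_all only: prod_decode_inverse)
      also have "\<dots> \<le> (\<Sum>n. ennreal (g (n + N)))"
      proof (rule suminf_le)
        fix n
        have "(\<Sum>i. ennreal (diameter (U (prod_encode (n, i))) powr s))
            = (\<Sum>i<card (\<C> (n + N)). ennreal (diameter (U (prod_encode (n, i))) powr s))"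
          using \<open>0 < s\<close> by (intro suminf_finite) (auto simp: U_def diameter_empty)
        also have "\<dots> \<le> (\<Sum>i<card (\<C> (n + N)). ennreal (\<delta> (n + N) powr s))"
          using \<open>0 < s\<close> diam[OF hC, of _ "n + N"]
          by (intro sum_mono ennreal_leI powr_mono2) (simp_all add: U_def)
        also have "\<dots> = ennreal (real (card (\<C> (n + N))) * \<delta> (n + N) powr s)"
          by (simp add: ennreal_mult ennreal_of_nat_eq_real_of_nat)
        also have "\<dots> \<le> ennreal (g (n + N))"
          by (intro ennreal_leI g)
        finally show "(\<Sum>i. ennreal (diameter (U (prod_encode (n, i))) powr s)) \<le> ennreal (g (n + N))" .
      qed auto
      also have "\<dots> = ennreal (\<Sum>n. g (n + N))"
        using g0 g(2) by (intro suminf_ennreal2) (auto simp: summable_iff_shift)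
      also have "\<dots> \<le> ennreal e"
        using N(2) by (intro ennreal_leI) auto
      finally show ?thesis by simp
    qed
    have "hausdorff_premeasure s \<epsilon> A \<le> 0"
      by (rule ennreal_le_epsilon) (rule *)
    then show ?thesis by simp
  qed
  then have "hausdorff_measure s A \<le> 0"
    unfolding hausdorff_measure_def by (intro SUP_least) simp
  then show ?thesis by simp
qed

section \<open>The exponent of the product measure and one-dimensional Cantor sets\<close>

text \<open>For \<open>L \<ge> 0\<close> the numerator of \<open>\<theta>\<^sub>i(L)\<close> is \<open>rate b L (b\<^sub>i)\<close> with \<open>b\<^sub>k = ln \<beta>\<^sub>k\<close>; unlike the
  original formula, this does not refer to the ordering of the eigenvalues.\<close>

definition rate :: "('i::finite \<Rightarrow> real) \<Rightarrow> real \<Rightarrow> real \<Rightarrow> real" where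
  "rate b L v = (\<Sum>j\<in>UNIV. min (v + L) (max v (b j)))"

lemma rate_le: "rate b L v \<le> real CARD('i) * (v + L)" for b :: "'i::finite \<Rightarrow> real"
  unfolding rate_def using sum_bounded_above[of UNIV "\<lambda>j. min (v + L) (max v (b j))" "v + L"] by simp

text \<open>At the breakpoints \<open>t = b i + L\<close> the right side equals
  \<open>rate b L (b i)\<close>, so the inequality holds there by assumption. It spreads to the left
  of the first breakpoint by scaling, between neighbouring breakpoints by concavity, and past the
  last one because the slope is then \<open>CARD('i) \<ge> s\<close>.\<close>

lemma scale_le_sum_max_min:
  fixes b :: "'i::finite \<Rightarrow> real"
  assumes s: "\<And>i. s * (b i + L) \<le> rate b L (b i)" and b: "\<And>i. 0 < b i" and "0 \<le> L" "0 < t"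
  shows "s * t \<le> (\<Sum>j\<in>UNIV. max (min (b j) t) (t - L))"
proof -
  let ?f = "\<lambda>t. \<Sum>j\<in>UNIV. max (min (b j) t) (t - L)"
  have f_rate: "rate b L v = ?f (v + L)" for v
    using \<open>0 \<le> L\<close> unfolding rate_def by (intro sum.cong) auto
  define A where "A = {v \<in> range b. v + L \<le> t}"
  define B where "B = {v \<in> range b. t < v + L}"
  have fin: "finite A" "finite B" unfolding A_def B_def by auto
  show ?thesis
  proof (cases "A = {}")
    case True
    \<comment> \<open>Here \<open>t\<close> lies left of the first breakpoint \<open>v + L\<close>;
      each summand shrinks at most proportionally from \<open>v + L\<close> to
      \<open>t\<close>.\<close>
    define v where "v = Min (range b)"
    have "v \<in> range b" unfolding v_def by (rule Min_in) auto
    then obtain i where i: "v = b i" by auto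
    have vb: "v \<le> b j" for j unfolding v_def by simp
    have vt: "t < v + L" using True i unfolding A_def by force
    have "s * t = (t / (v + L)) * (s * (v + L))"
      using vt \<open>0 < t\<close> by simp
    also have "\<dots> \<le> (t / (v + L)) * ?f (v + L)"
      using s[of i] f_rate[of v] vt \<open>0 < t\<close> i by (intro mult_left_mono) auto
    also have "\<dots> = (\<Sum>j\<in>UNIV. (t / (v + L)) * max (min (b j) (v + L)) v)"
      by (simp add: sum_distrib_left)
    also have "\<dots> \<le> ?f t"
    proof (rule sum_mono)
      fix j
      have "(t / (v + L)) * max (min (b j) (v + L)) v \<le> (t / (v + L)) * min (b j) (v + L)"
        using vb[of j] vt \<open>0 < t\<close> \<open>0 \<le> L\<close> by (intro mult_left_mono) auto
      also have "\<dots> \<le> min (b j) t"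
      proof -
        have "(t / (v + L)) * min (b j) (v + L) \<le> 1 * min (b j) (v + L)"
          using vt \<open>0 < t\<close> b[of j] by (intro mult_right_mono) auto
        moreover have "(t / (v + L)) * min (b j) (v + L) \<le> (t / (v + L)) * (v + L)"
          using vt \<open>0 < t\<close> by (intro mult_left_mono) auto
        ultimately show ?thesis using vt \<open>0 < t\<close> by auto
      qed
      also have "\<dots> \<le> max (min (b j) t) (t - L)" by simp
      finally show "(t / (v + L)) * max (min (b j) (v + L)) v \<le> max (min (b j) t) (t - L)" .
    qed
    finally show ?thesis .
  next
    case False
    \<comment> \<open>The last breakpoint not exceeding \<open>t\<close> is
      \<open>u + L\<close>.\<close>
    define u where "u = Max A"
    have uA: "u \<in> A" unfolding u_def by (rule Max_in[OF fin(1) False])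
    then obtain i where i: "u = b i" "u + L \<le> t" unfolding A_def by auto
    have uu: "b j \<le> u" if "b j + L \<le> t" for j
      unfolding u_def using that by (intro Max_ge fin) (auto simp: A_def)
    have su: "s * (u + L) \<le> ?f (u + L)" using s[of i] f_rate i by simp
    show ?thesis
    proof (cases "B = {}")
      case True
      then have *: "b j + L \<le> t" for j unfolding B_def by (fastforce simp: not_less)
      \<comment> \<open>No breakpoint lies beyond \<open>t\<close>, so from \<open>u + L\<close> on
        every summand grows with slope one.\<close>
      have s_card: "s \<le> real CARD('i)"
        using order_trans[OF s[of i] rate_le] b[of i] \<open>0 \<le> L\<close> by simp
      have "s * t = s * (u + L) + s * (t - L - u)" by (simp add: algebra_simps)
      also have "\<dots> \<le> ?f (u + L) + real CARD('i) * (t - L - u)"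
        using su s_card i by (intro add_mono mult_right_mono) auto
      also have "?f (u + L) = (\<Sum>j::'i\<in>UNIV. u)"
        using uu[OF *] by (simp add: max_absorb2 min.coboundedI1)
      also have "\<dots> + real CARD('i) * (t - L - u) = (\<Sum>j::'i\<in>UNIV. t - L)"
        by (simp add: algebra_simps)
      also have "\<dots> \<le> ?f t" by (intro sum_mono) auto
      finally show ?thesis .
    next
      case False
      define v where "v = Min B"
      have "v \<in> B" unfolding v_def by (rule Min_in[OF fin(2) False])
      then obtain i' where i': "v = b i'" "t < v + L" unfolding B_def by auto
      have vv: "v \<le> b j" if "t < b j + L" for j
        unfolding v_def using that by (intro Min_le fin) (auto simp: B_def)
      have sv: "s * (v + L) \<le> ?f (v + L)" using s[of i'] f_rate i' by simp
      have uv: "u < v" using i i' by linarith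
      \<comment> \<open>The weight expressing \<open>t\<close> as a convex combination of the
        neighbouring breakpoints. No \<open>b j\<close> lies strictly between \<open>u\<close> and
        \<open>v\<close>, so on this interval a summand is either the linear \<open>t - L\<close> or
        the concave \<open>min (b j) t\<close>.\<close>
      define q where "q = (t - (u + L)) / (v - u)"
      have q: "0 \<le> q" "q \<le> 1" "t = (1 - q) * (u + L) + q * (v + L)"
      proof -
        show "0 \<le> q" "q \<le> 1" unfolding q_def using uv i i' by auto
        have "q * (v - u) = t - (u + L)" unfolding q_def using uv by simp
        then show "t = (1 - q) * (u + L) + q * (v + L)" by (simp add: algebra_simps)
      qed
      have "s * t = (1 - q) * (s * (u + L)) + q * (s * (v + L))"
        by (subst q(3)) (simp add: algebra_simps)
      also have "\<dots> \<le> (1 - q) * ?f (u + L) + q * ?f (v + L)"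
        using q su sv by (intro add_mono mult_left_mono) auto
      also have "\<dots> = (\<Sum>j\<in>UNIV. (1 - q) * max (min (b j) (u + L)) u + q * max (min (b j) (v + L)) v)"
        by (simp add: sum_distrib_left sum.distrib)
      also have "\<dots> \<le> ?f t"
      proof (rule sum_mono)
        fix j
        show "(1 - q) * max (min (b j) (u + L)) u + q * max (min (b j) (v + L)) v
            \<le> max (min (b j) t) (t - L)"
        proof (cases "b j + L \<le> t")
          case True
          then have "b j \<le> u" by (rule uu)
          then have "(1 - q) * max (min (b j) (u + L)) u + q * max (min (b j) (v + L)) v
             = (1 - q) * u + q * v"
            using uv \<open>0 \<le> L\<close> by (simp add: max_def min_def)
          also have "\<dots> = t - L" using q(3) by (simp add: algebra_simps)
          finally show ?thesis by simp
        next
          case False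
          then have "v \<le> b j" using vv by simp
          then have "(1 - q) * max (min (b j) (u + L)) u + q * max (min (b j) (v + L)) v
             = (1 - q) * min (b j) (u + L) + q * min (b j) (v + L)"
            using uv \<open>0 \<le> L\<close> by (simp add: max_def min_def)
          also have "\<dots> \<le> min (b j) t"
          proof -
            have "(1 - q) * min (b j) (u + L) + q * min (b j) (v + L) \<le> (1 - q) * b j + q * b j"
              using q by (intro add_mono mult_left_mono) auto
            moreover have "(1 - q) * min (b j) (u + L) + q * min (b j) (v + L)
                \<le> (1 - q) * (u + L) + q * (v + L)"
              using q by (intro add_mono mult_left_mono) auto
            ultimately show ?thesis using q(3) by (simp add: algebra_simps)
          qed
          also have "\<dots> \<le> max (min (b j) t) (t - L)" by simp
          finally show ?thesis .
        qed
      qed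
      finally show ?thesis .
    qed
  qed
qed

text \<open>By homogeneity this is the previous bound at \<open>t = x / n\<close>. The case
  \<open>n = 0\<close> is treated separately, since the Cantor construction starts at time 0; there
  the right side is \<open>CARD('i) * x\<close>.\<close>

lemma scale_le_sum_max_min_nat:
  fixes b :: "'i::finite \<Rightarrow> real"
  assumes s: "\<And>i. s * (b i + L) \<le> rate b L (b i)" and b: "\<And>i. 0 < b i" and "0 \<le> L" "0 < x"
  shows "s * x \<le> (\<Sum>j\<in>UNIV. max (min (real n * b j) x) (x - real n * L))"
proof (cases "n = 0")
  case True
  have "s \<le> real CARD('i)"
    using order_trans[OF s[of undefined] rate_le] b[of undefined] \<open>0 \<le> L\<close> by simp
  then show ?thesis using True \<open>0 < x\<close> by (simp add: max_def min_def)
next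
  case False
  have "s * x = real n * (s * (x / real n))" using False by simp
  also have "\<dots> \<le> real n * (\<Sum>j\<in>UNIV. max (min (b j) (x / real n)) (x / real n - L))"
    using False assms by (intro mult_left_mono scale_le_sum_max_min) auto
  also have "\<dots> = (\<Sum>j\<in>UNIV. max (min (real n * b j) x) (x - real n * L))"
    using False
    by (simp add: sum_distrib_left max_mult_distrib_left min_mult_distrib_left right_diff_distrib)
  finally show ?thesis .
qed

section \<open>One-dimensional Cantor sets, described by the left endpoints of their
  intervals\<close>

text \<open>Below each point \<open>x\<close> of level \<open>j\<close> come
  \<open>m (Suc j)\<close> consecutive points of the shifted lattice
  \<open>w (Suc j) * (\<alpha> + \<int>)\<close>, beginning with the first one that is not less than
  \<open>x\<close>. Division by \<open>w j\<close> thus sends every point of level \<open>j\<close>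
  to \<open>\<alpha>\<close> modulo one.\<close>

fun cantor_pts :: "(nat \<Rightarrow> real) \<Rightarrow> (nat \<Rightarrow> nat) \<Rightarrow> real \<Rightarrow> nat \<Rightarrow> real set" where
  "cantor_pts w m \<alpha> 0 = {\<alpha> * w 0}"
| "cantor_pts w m \<alpha> (Suc j) = (\<Union>x\<in>cantor_pts w m \<alpha> j.
    (\<lambda>i. w (Suc j) * (\<alpha> + of_int \<lceil>x / w (Suc j) - \<alpha>\<rceil> + real i)) ` {..<m (Suc j)})"

text \<open>The intervals of level \<open>j\<close> are \<open>{x..x + \<rho> j}\<close>. The bound
  \<open>\<rho> j < w j\<close> keeps them disjoint, and the extra 1 in the last assumption pays for
  rounding up to the next lattice.\<close>

locale cantor_scheme =
  fixes w \<rho> :: "nat \<Rightarrow> real" and m :: "nat \<Rightarrow> nat" and \<alpha> :: real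
  assumes w: "\<And>j. 0 < w j" and \<rho>: "\<And>j. 0 \<le> \<rho> j" "\<And>j. \<rho> j < w j"
    and m: "\<And>j. 0 < m (Suc j)" "\<And>j. (real (m (Suc j)) + 1) * w (Suc j) \<le> \<rho> j"
begin

abbreviation "pts \<equiv> cantor_pts w m \<alpha>"

lemma pts_lattice: "x \<in> pts j \<Longrightarrow> \<exists>p::int. x = w j * (\<alpha> + of_int p)"
proof (cases j)
  case 0
  assume "x \<in> pts j"
  then show ?thesis using 0 by (intro exI[of _ 0]) simp
next
  case (Suc i)
  assume "x \<in> pts j"
  then obtain y k where "x = w (Suc i) * (\<alpha> + of_int \<lceil>y / w (Suc i) - \<alpha>\<rceil> + real k)"
    using Suc by auto
  then show ?thesis using Suc by (intro exI[of _ "\<lceil>y / w (Suc i) - \<alpha>\<rceil> + int k"]) simp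
qed

lemma pts_separated:
  assumes "x \<in> pts j" "y \<in> pts j" "x < y" shows "x + w j \<le> y"
proof -
  obtain p q :: int where pq: "x = w j * (\<alpha> + of_int p)" "y = w j * (\<alpha> + of_int q)"
    using pts_lattice assms by metis
  then have "p < q" using assms(3) w[of j] by (simp add: mult_less_cancel_left)
  then have "real_of_int p + 1 \<le> of_int q" by linarith
  then have "w j * (\<alpha> + (of_int p + 1)) \<le> w j * (\<alpha> + of_int q)"
    using w[of j] by (intro mult_left_mono) auto
  then show ?thesis using pq by (simp add: algebra_simps)
qed

definition children :: "nat \<Rightarrow> real \<Rightarrow> real set" where
  "children j x = (\<lambda>i. w (Suc j) * (\<alpha> + of_int \<lceil>x / w (Suc j) - \<alpha>\<rceil> + real i)) ` {..<m (Suc j)}"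

lemma pts_Suc: "pts (Suc j) = (\<Union>x\<in>pts j. children j x)"
  by (simp add: children_def)

lemma card_children: "finite (children j x)" "card (children j x) = m (Suc j)"
proof -
  show "finite (children j x)" by (simp add: children_def)
  have "inj_on (\<lambda>i. w (Suc j) * (\<alpha> + of_int \<lceil>x / w (Suc j) - \<alpha>\<rceil> + real i)) {..<m (Suc j)}"
    using w[of "Suc j"] by (intro inj_onI) simp
  then show "card (children j x) = m (Suc j)"
    unfolding children_def by (simp add: card_image)
qed

text \<open>Rounding up moves the first child by less than one step, the last child is
  \<open>m (Suc j) - 1\<close> steps further, and its interval is shorter than a step; together this
  is less than \<open>m (Suc j) + 1\<close> steps.\<close>

lemma children_subset:
  assumes "y \<in> children j x" shows "{y..y + \<rho> (Suc j)} \<subseteq> {x..x + \<rho> j}"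
proof -
  let ?w = "w (Suc j)" and ?p = "real_of_int \<lceil>x / w (Suc j) - \<alpha>\<rceil>"
  obtain i where i: "i < m (Suc j)" "y = ?w * (\<alpha> + ?p + real i)"
    using assms unfolding children_def by auto
  have "x / ?w \<le> \<alpha> + ?p" "\<alpha> + ?p < x / ?w + 1"
    using ceiling_correct[of "x / ?w - \<alpha>"] by linarith+
  then have 1: "x \<le> ?w * (\<alpha> + ?p)" "?w * (\<alpha> + ?p) < x + ?w"
    using w[of "Suc j"] by (auto simp: field_simps)
  have "?w * real i + ?w \<le> ?w * real (m (Suc j))"
    using mult_left_mono[of "real i + 1" "real (m (Suc j))" ?w] i(1) w[of "Suc j"]
    by (simp add: algebra_simps)
  moreover have "0 \<le> ?w * real i" using w[of "Suc j"] by simp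
  moreover have "y = ?w * (\<alpha> + ?p) + ?w * real i" using i(2) by (simp add: algebra_simps)
  moreover have "?w * real (m (Suc j)) + ?w \<le> \<rho> j" using m(2)[of j] by (simp add: algebra_simps)
  ultimately have "x \<le> y" "y + \<rho> (Suc j) \<le> x + \<rho> j"
    using 1 \<rho>(2)[of "Suc j"] by linarith+
  then show ?thesis by auto
qed

text \<open>Children lie in the intervals of their parents, and distinct parents are at least
  \<open>w j > \<rho> j\<close> apart.\<close>

lemma children_disjoint:
  assumes "x \<in> pts j" "y \<in> pts j" "x \<noteq> y" shows "children j x \<inter> children j y = {}"
proof -
  have "False" if "z \<in> children j x" "z \<in> children j y" for z
  proof -
    have "z \<in> {x..x + \<rho> j}" "z \<in> {y..y + \<rho> j}"
      using children_subset[OF that(1)] children_subset[OF that(2)] \<rho>(1)[of "Suc j"] by auto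
    then show False
      using pts_separated[OF assms(1,2)] pts_separated[OF assms(2,1)] assms(3) \<rho>(2)[of j] by force
  qed
  then show ?thesis by blast
qed

lemma finite_pts: "finite (pts j)"
  by (induction j) auto

lemma card_pts_Suc: "card (pts (Suc j)) = m (Suc j) * card (pts j)"
proof -
  have "card (pts (Suc j)) = (\<Sum>x\<in>pts j. card (children j x))"
    unfolding pts_Suc using finite_pts card_children(1) children_disjoint
    by (intro card_UN_disjoint) auto
  then show ?thesis by (simp add: card_children)
qed

lemma card_pts_pos: "0 < card (pts j)"
  by (induction j) (simp_all only: card_pts_Suc m, simp_all add: m)

text \<open>Counting intervals that meet \<open>I\<close>, rather than points in \<open>I\<close>,
  makes the property pass from a child to its parent.\<close>

definition hits :: "nat \<Rightarrow> real set \<Rightarrow> real set" where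
  "hits j I = {x \<in> pts j. {x..x + \<rho> j} \<inter> I \<noteq> {}}"

lemma card_hits_Suc: "card (hits (Suc j) I) \<le> m (Suc j) * card (hits j I)"
proof -
  have "hits (Suc j) I \<subseteq> (\<Union>x\<in>hits j I. children j x)"
    using children_subset unfolding hits_def pts_Suc by blast
  then have "card (hits (Suc j) I) \<le> card (\<Union>x\<in>hits j I. children j x)"
    by (intro card_mono finite_UN_I) (auto simp: hits_def finite_pts card_children)
  also have "\<dots> \<le> (\<Sum>x\<in>hits j I. card (children j x))"
    by (rule card_UN_le) (auto simp: hits_def finite_pts)
  finally show ?thesis by (simp add: card_children mult.commute)
qed

text \<open>The proportion of intervals meeting \<open>I\<close> cannot grow with the level, since
  every interval has equally many children. The inequality is multiplied out to avoid
  division.\<close>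

lemma card_hits_mono:
  assumes "j \<le> J"
  shows "card (hits J I) * card (pts j) \<le> card (hits j I) * card (pts J)"
  using assms
proof (induction J rule: dec_induct)
  case (step J)
  have "card (hits (Suc J) I) * card (pts j) \<le> m (Suc J) * (card (hits J I) * card (pts j))"
    using mult_right_mono[OF card_hits_Suc, of "card (pts j)" J I] by (simp add: mult_ac)
  also have "\<dots> \<le> m (Suc J) * (card (hits j I) * card (pts J))"
    using step.IH by simp
  finally show ?case by (simp only: card_pts_Suc mult_ac)
qed simp

text \<open>The left endpoints in question lie between \<open>t - w j\<close> and
  \<open>t + r\<close> and are \<open>w j\<close>-separated, so rounding down \<open>x / w j\<close>
  is injective on them.\<close>

lemma card_hits_le:
  assumes "0 \<le> r"
  shows "real (card (hits j {t..t + r})) \<le> r / w j + 3"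
proof -
  let ?H = "hits j {t..t + r}"
  let ?g = "\<lambda>x. \<lfloor>x / w j\<rfloor>"
  have inj: "inj_on ?g ?H"
  proof (rule inj_onI)
    have *: "?g x < ?g y" if "x \<in> pts j" "y \<in> pts j" "x < y" for x y
    proof -
      have "x / w j + 1 \<le> y / w j"
        using divide_right_mono[OF pts_separated[OF that], of "w j"] w[of j]
        by (simp add: add_divide_distrib)
      then show ?thesis by linarith
    qed
    show "x = y" if "x \<in> ?H" "y \<in> ?H" "?g x = ?g y" for x y
      using *[of x y] *[of y x] that unfolding hits_def by (metis (no_types, lifting) less_irrefl linorder_neqE mem_Collect_eq)
  qed
  have "?g ` ?H \<subseteq> {\<lfloor>t / w j - 1\<rfloor>..\<lfloor>(t + r) / w j\<rfloor>}"
  proof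
    fix z assume "z \<in> ?g ` ?H"
    then obtain x where x: "x \<in> ?H" "z = ?g x" by blast
    then have "x \<le> t + r" "t \<le> x + \<rho> j" unfolding hits_def by auto
    then have "x / w j \<le> (t + r) / w j" "t / w j \<le> (x + w j) / w j"
      using w[of j] \<rho>(2)[of j] by (auto intro: divide_right_mono)
    then have "x / w j \<le> (t + r) / w j" "t / w j - 1 \<le> x / w j"
      using w[of j] by (simp_all add: add_divide_distrib)
    then show "z \<in> {\<lfloor>t / w j - 1\<rfloor>..\<lfloor>(t + r) / w j\<rfloor>}"
      using x(2) floor_mono[of "t / w j - 1" "x / w j"] floor_mono[of "x / w j" "(t + r) / w j"]
      by (simp only: atLeastAtMost_iff)
  qed
  then have "card (?g ` ?H) \<le> card {\<lfloor>t / w j - 1\<rfloor>..\<lfloor>(t + r) / w j\<rfloor>}"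
    by (intro card_mono) auto
  then have "card ?H \<le> nat (\<lfloor>(t + r) / w j\<rfloor> + 1 - \<lfloor>t / w j - 1\<rfloor>)"
    using card_image[OF inj] by simp
  moreover have "real_of_int (\<lfloor>(t + r) / w j\<rfloor> + 1 - \<lfloor>t / w j - 1\<rfloor>) \<le> r / w j + 3"
    by (simp add: add_divide_distrib) linarith
  moreover have "0 \<le> r / w j + 3" using assms w[of j] by simp
  ultimately show ?thesis by linarith
qed

text \<open>An upper bound for the uniform mass of a short interval, obtained at level
  \<open>j\<close> and valid at every finer level \<open>J\<close>; the choice of \<open>j\<close>
  remains free.\<close>

lemma card_pts_Int_le:
  assumes "j \<le> J" "0 \<le> r"
  shows "real (card (pts J \<inter> {t..t + r})) \<le> (r / w j + 3) / real (card (pts j)) * real (card (pts J))"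
proof -
  have "pts J \<inter> {t..t + r} \<subseteq> hits J {t..t + r}"
    unfolding hits_def using \<rho>(1)[of J] by force
  then have "card (pts J \<inter> {t..t + r}) \<le> card (hits J {t..t + r})"
    by (intro card_mono) (auto simp: hits_def finite_pts)
  then have "real (card (pts J \<inter> {t..t + r})) * real (card (pts j))
      \<le> real (card (hits J {t..t + r}) * card (pts j))"
    by (simp add: mult_right_mono)
  also have "\<dots> \<le> real (card (hits j {t..t + r}) * card (pts J))"
    using card_hits_mono[OF assms(1)] by (simp only: of_nat_le_iff)
  also have "\<dots> \<le> (r / w j + 3) * real (card (pts J))"
    using card_hits_le[OF assms(2)] by (simp add: mult_right_mono)
  finally show ?thesis using card_pts_pos[of j] by (simp add: field_simps)
qed

lemma pts_intervals_decreasing: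
  "(\<Union>x\<in>pts (Suc j). {x..x + \<rho> (Suc j)}) \<subseteq> (\<Union>x\<in>pts j. {x..x + \<rho> j})"
  using children_subset unfolding pts_Suc by blast

end

section \<open>Coverings, the torus and integer matrices\<close>

lemma finite_card_cart:
  fixes X :: "'n::finite \<Rightarrow> 'a set"
  assumes "\<And>k. finite (X k)"
  shows "finite {t::'a^'n. \<forall>k. t $ k \<in> X k}" "card {t::'a^'n. \<forall>k. t $ k \<in> X k} = (\<Prod>k\<in>UNIV. card (X k))"
proof -
  have eq: "{t::'a^'n. \<forall>k. t $ k \<in> X k} = vec_lambda ` (Pi\<^sub>E UNIV X)"
  proof (intro equalityI subsetI)
    fix t :: "'a^'n" assume "t \<in> {t. \<forall>k. t $ k \<in> X k}"
    then show "t \<in> vec_lambda ` (Pi\<^sub>E UNIV X)"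
      by (intro image_eqI[of _ _ "\<lambda>k. t $ k"]) auto
  qed auto
  have inj: "inj_on (vec_lambda :: ('n \<Rightarrow> 'a) \<Rightarrow> _) (Pi\<^sub>E UNIV X)"
    by (intro inj_onI) (simp add: vec_lambda_inject)
  show "finite {t::'a^'n. \<forall>k. t $ k \<in> X k}"
    unfolding eq using assms by (intro finite_imageI finite_PiE) auto
  show "card {t::'a^'n. \<forall>k. t $ k \<in> X k} = (\<Prod>k\<in>UNIV. card (X k))"
    unfolding eq card_image[OF inj] by (rule card_PiE) simp
qed

lemma interval_grid_cover:
  fixes u v r :: real
  assumes "0 < r" "u \<le> v"
  shows "\<exists>X. finite X \<and> real (card X) \<le> (v - u) / r + 1 \<and> {u..v} \<subseteq> (\<Union>t\<in>X. {t..t + r})"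
proof (intro exI conjI)
  let ?N = "nat \<lfloor>(v - u) / r\<rfloor>"
  let ?X = "(\<lambda>j. u + real j * r) ` {..?N}"
  show "finite ?X" by simp
  have "0 \<le> (v - u) / r" using assms by simp
  then have "real (Suc ?N) \<le> (v - u) / r + 1" by linarith
  moreover have "card ?X \<le> Suc ?N"
    using card_image_le[of "{..?N}" "\<lambda>j. u + real j * r"] by simp
  ultimately show "real (card ?X) \<le> (v - u) / r + 1" by linarith
  show "{u..v} \<subseteq> (\<Union>t\<in>?X. {t..t + r})"
  proof
    fix y assume y: "y \<in> {u..v}"
    let ?j = "nat \<lfloor>(y - u) / r\<rfloor>"
    have "(y - u) / r \<le> (v - u) / r" using y assms by (intro divide_right_mono) auto
    then have "?j \<le> ?N" by (intro nat_mono floor_mono)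
    have "0 \<le> (y - u) / r" using y assms by simp
    then have "real ?j \<le> (y - u) / r" "(y - u) / r \<le> real ?j + 1" by linarith+
    then have "real ?j * r \<le> y - u" "y - u \<le> (real ?j + 1) * r"
      using assms by (simp_all add: pos_le_divide_eq pos_divide_le_eq)
    then have "y \<in> {u + real ?j * r..u + real ?j * r + r}" by (simp add: algebra_simps)
    then show "y \<in> (\<Union>t\<in>?X. {t..t + r})" using \<open>?j \<le> ?N\<close> by blast
  qed
qed

text \<open>If \<open>bi + L \<le> max bi bk\<close>, a grid on the whole interval is economical
  enough. Otherwise there are about \<open>exp (n * bk)\<close> neighbourhoods of lattice points,
  each needing about \<open>1 + exp (n * (bi - bk))\<close> intervals, which gives
  \<open>exp (n * max bi bk)\<close>. The constant \<open>C\<close> serves both cases and all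
  \<open>n\<close>.\<close>

lemma cover_near_lattice:
  fixes R K bi bk L \<alpha> :: real
  assumes pos: "0 \<le> R" "0 \<le> K" "0 < bk" "0 < bi + L" "0 < bk + L"
  shows "\<exists>C>0. \<forall>n::nat. \<exists>X. finite X \<and> real (card X) \<le> C * exp (real n * min (bi + L) (max bi bk)) \<and>
    {y. \<bar>y\<bar> \<le> R \<and> (\<exists>p::int. \<bar>exp (real n * bk) * y - \<alpha> - of_int p\<bar> \<le> K * exp (- real n * L))}
      \<subseteq> (\<Union>t\<in>X. {t..t + exp (- real n * (bi + L))})"
proof -
  define c where "c = R + \<bar>\<alpha>\<bar> + K"
  define C where "C = (2 * R + 1) + (2 * c + 1) * (2 * K + 1)"
  have c0: "0 \<le> c" using pos by (simp add: c_def)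
  have "0 \<le> (2 * c + 1) * (2 * K + 1)" using c0 pos by simp
  then have C: "0 < C" "2 * R + 1 \<le> C" "(2 * c + 1) * (2 * K + 1) \<le> C"
    using pos unfolding C_def by linarith+
  have "\<exists>X. finite X \<and> real (card X) \<le> C * exp (real n * min (bi + L) (max bi bk)) \<and>
    {y. \<bar>y\<bar> \<le> R \<and> (\<exists>p::int. \<bar>exp (real n * bk) * y - \<alpha> - of_int p\<bar> \<le> K * exp (- real n * L))}
      \<subseteq> (\<Union>t\<in>X. {t..t + exp (- real n * (bi + L))})" (is "\<exists>X. _ \<and> _ \<and> ?S \<subseteq> _") for n :: nat
  proof (cases "bi + L \<le> max bi bk")
    case True
    let ?r = "exp (- real n * (bi + L))"
    obtain X where X: "finite X" "real (card X) \<le> (R - (- R)) / ?r + 1" "{-R..R} \<subseteq> (\<Union>t\<in>X. {t..t + ?r})"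
      using interval_grid_cover[of ?r "-R" R] pos by auto
    have "?r = inverse (exp (real n * (bi + L)))" using exp_minus[of "real n * (bi + L)"] by simp
    then have inv: "(R - (- R)) / ?r = 2 * R * exp (real n * (bi + L))"
      by (simp add: divide_inverse)
    have "1 \<le> exp (real n * (bi + L))" using pos by simp
    then have "real (card X) \<le> (2 * R + 1) * exp (real n * (bi + L))"
      using X(2) unfolding inv distrib_right by linarith
    also have "\<dots> \<le> C * exp (real n * (bi + L))" using C by (intro mult_right_mono) auto
    finally have "real (card X) \<le> C * exp (real n * min (bi + L) (max bi bk))"
      using True by (simp add: min_def)
    moreover have "?S \<subseteq> {-R..R}" by auto
    ultimately show ?thesis using X(1,3) by blast
  next
    case False
    let ?r = "exp (- real n * (bi + L))"
    define B where "B = exp (real n * bk)"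
    define h where "h = K * exp (- real n * L)"
    have B1: "1 \<le> B" unfolding B_def using pos by simp
    have h0: "0 \<le> h" unfolding h_def using pos by simp
    \<comment> \<open>\<open>L\<close> may be negative; the assumption \<open>0 < bk + L\<close>
      still bounds \<open>h\<close> by \<open>K * B\<close>.\<close>
    have "- real n * L \<le> real n * bk"
      using mult_left_mono[of "-L" bk "real n"] pos by simp
    then have hB: "h \<le> K * B" unfolding h_def B_def using pos by (intro mult_left_mono) auto
    \<comment> \<open>Only these integers can be close to \<open>B * y - \<alpha>\<close> when
      \<open>\<bar>y\<bar> \<le> R\<close>.\<close>
    define Z where "Z = {p::int. \<bar>real_of_int p\<bar> \<le> B * c}"
    have Bc: "0 \<le> B * c" using B1 c0 by simp
    have Z_eq: "Z = {- \<lfloor>B * c\<rfloor>..\<lfloor>B * c\<rfloor>}"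
      unfolding Z_def by (auto simp: abs_le_iff; linarith)
    have Zfin: "finite Z" unfolding Z_eq by simp
    have "real (card Z) \<le> 2 * (B * c) + 1"
      unfolding Z_eq using Bc by simp
    also have "\<dots> \<le> B * (2 * c + 1)" using B1 by (simp add: algebra_simps)
    finally have Zcard: "real (card Z) \<le> B * (2 * c + 1)" .
    define lo where "lo p = (\<alpha> + real_of_int p - h) / B" for p
    define hi where "hi p = (\<alpha> + real_of_int p + h) / B" for p
    define cov where "cov p X \<longleftrightarrow> finite X \<and> real (card X) \<le> (hi p - lo p) / ?r + 1
      \<and> {lo p..hi p} \<subseteq> (\<Union>t\<in>X. {t..t + ?r})" for p X
    have "lo p \<le> hi p" for p
      unfolding lo_def hi_def using h0 B1 by (intro divide_right_mono) auto
    then have "\<exists>X. cov p X" for p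
      unfolding cov_def by (intro interval_grid_cover) auto
    then have "\<forall>p. \<exists>X. cov p X" by blast
    from choice[OF this] obtain X where "\<forall>p. cov p (X p)" by blast
    then have X: "finite (X p)" "real (card (X p)) \<le> (hi p - lo p) / ?r + 1"
      "{lo p..hi p} \<subseteq> (\<Union>t\<in>X p. {t..t + ?r})" for p
      unfolding cov_def by blast+
    have "h / B / ?r = K * exp (real n * (bi - bk))"
    proof -
      have "h / B / ?r = K * (exp (- real n * L) / exp (real n * bk) / ?r)"
        unfolding h_def B_def by simp
      also have "\<dots> = K * exp (- real n * L - real n * bk - (- real n * (bi + L)))"
        by (simp only: exp_diff)
      also have "- real n * L - real n * bk - (- real n * (bi + L)) = real n * (bi - bk)"
        by (simp add: algebra_simps)
      finally show ?thesis .
    qed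
    moreover have "(hi p - lo p) / ?r = 2 * (h / B / ?r)" for p
      unfolding lo_def hi_def by (simp add: diff_divide_distrib add_divide_distrib)
    ultimately have Xcard: "real (card (X p)) \<le> 2 * K * exp (real n * (bi - bk)) + 1" for p
      using X(2)[of p] by simp
    have "?S \<subseteq> (\<Union>t\<in>(\<Union>p\<in>Z. X p). {t..t + ?r})"
    proof
      fix y assume "y \<in> ?S"
      then obtain p :: int where y: "\<bar>y\<bar> \<le> R" "\<bar>B * y - \<alpha> - of_int p\<bar> \<le> h"
        unfolding B_def h_def by blast
      have "\<bar>B * y\<bar> \<le> B * R" using y(1) B1 by (simp add: abs_mult)
      then have "\<bar>real_of_int p\<bar> \<le> B * R + \<bar>\<alpha>\<bar> + h" using y(2) by linarith
      also have "\<dots> \<le> B * R + B * \<bar>\<alpha>\<bar> + K * B"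
        using hB B1 by (intro add_mono) (auto simp: mult_le_cancel_right1)
      also have "\<dots> = B * c" by (simp add: c_def algebra_simps)
      finally have "p \<in> Z" by (simp add: Z_def)
      have "\<alpha> + of_int p - h \<le> B * y" "B * y \<le> \<alpha> + of_int p + h" using y(2) by linarith+
      then have "y \<in> {lo p..hi p}"
        using B1 by (simp add: lo_def hi_def pos_divide_le_eq pos_le_divide_eq mult.commute)
      then show "y \<in> (\<Union>t\<in>(\<Union>p\<in>Z. X p). {t..t + ?r})" using X(3)[of p] \<open>p \<in> Z\<close> by blast
    qed
    moreover have "finite (\<Union>p\<in>Z. X p)" using Zfin X(1) by simp
    moreover have "real (card (\<Union>p\<in>Z. X p)) \<le> C * exp (real n * min (bi + L) (max bi bk))"
    proof -
      have "real (card (\<Union>p\<in>Z. X p)) \<le> (\<Sum>p\<in>Z. real (card (X p)))"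
        using card_UN_le[OF Zfin, of X] by (metis of_nat_le_iff of_nat_sum)
      also have "\<dots> \<le> real (card Z) * (2 * K * exp (real n * (bi - bk)) + 1)"
        using Xcard by (rule sum_bounded_above)
      also have "\<dots> \<le> B * (2 * c + 1) * (2 * K * exp (real n * (bi - bk)) + 1)"
        using Zcard pos by (intro mult_right_mono) auto
      also have "\<dots> = (2 * c + 1) * (2 * K * (exp (real n * bk) * exp (real n * (bi - bk))) + exp (real n * bk))"
        unfolding B_def by (simp add: algebra_simps)
      also have "exp (real n * bk) * exp (real n * (bi - bk)) = exp (real n * bi)"
        by (simp add: exp_add[symmetric] algebra_simps)
      also have "(2 * c + 1) * (2 * K * exp (real n * bi) + exp (real n * bk))
          \<le> (2 * c + 1) * (2 * K * exp (real n * max bi bk) + exp (real n * max bi bk))"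
        using c0 pos by (intro mult_left_mono add_mono) (auto intro: mult_left_mono)
      also have "\<dots> = (2 * c + 1) * (2 * K + 1) * exp (real n * max bi bk)"
        by (simp add: algebra_simps)
      also have "\<dots> \<le> C * exp (real n * max bi bk)" using C by (intro mult_right_mono) auto
      finally show ?thesis using False by (simp add: min_def)
    qed
    ultimately show ?thesis by blast
  qed
  with C(1) show ?thesis by blast
qed

section \<open>Distances and representatives on the torus, and bounds for matrices\<close>

lemma nint_dist_le_iff: "nint_dist t \<le> r \<longleftrightarrow> (\<exists>p::int. \<bar>t - of_int p\<bar> \<le> r)"
proof
  show "nint_dist t \<le> r \<Longrightarrow> \<exists>p::int. \<bar>t - of_int p\<bar> \<le> r"
    unfolding nint_dist_def by blast
qed (auto intro: order_trans[OF nint_dist_le])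

text \<open>No nonzero integer is closer to \<open>t\<close> than 0 is. This turns torus distances
  back into real ones for nearby representatives.\<close>

lemma nint_dist_eq_abs: "\<bar>t\<bar> \<le> 1 / 2 \<Longrightarrow> nint_dist t = \<bar>t\<bar>"
proof (rule antisym)
  show "nint_dist t \<le> \<bar>t\<bar>" using nint_dist_le[of t 0] by simp
  assume t: "\<bar>t\<bar> \<le> 1 / 2"
  show "\<bar>t\<bar> \<le> nint_dist t"
  proof (cases "round t = 0")
    case False
    then have "1 \<le> \<bar>real_of_int (round t)\<bar>" by linarith
    then show ?thesis using t unfolding nint_dist_def by linarith
  qed (simp add: nint_dist_def)
qed

lemma dist_abs_torus_le_iff:
  "dist (abs_torus x) (abs_torus y) \<le> r \<longleftrightarrow> (\<forall>i. nint_dist (x $ i - y $ i) \<le> r)"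
  by (simp add: dist_torus.abs_eq)

lemma abs_torus_representative:
  obtains x where "z = abs_torus x" "\<And>i. \<bar>x $ i\<bar> \<le> 1"
proof -
  define u where "u = rep_torus z"
  have u: "z = abs_torus u" unfolding u_def by (rule Quotient_abs_rep[OF Quotient_torus, symmetric])
  let ?x = "\<chi> i. frac (u $ i)"
  have "torus_rel u ?x" unfolding torus_rel_def by (simp add: frac_def)
  then have "z = abs_torus ?x" unfolding u by (rule Quotient_rel_abs[OF Quotient_torus])
  moreover have "\<bar>?x $ i\<bar> \<le> 1" for i
    using frac_ge_0[of "u $ i"] frac_lt_1[of "u $ i"] by simp
  ultimately show ?thesis using that by blast
qed

lemma torus_map_funpow_abs:
  "(torus_map T ^^ n) (abs_torus x) = abs_torus (((*v) (map_matrix real_of_int T) ^^ n) x)"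
  by (induction n) (simp_all add: torus_map.abs_eq)

lemma matrix_vector_bound:
  fixes A :: "real ^ 'n ^ 'm"
  obtains C where "1 \<le> C" "\<And>x e i. (\<And>j. \<bar>x $ j\<bar> \<le> e) \<Longrightarrow> \<bar>(A *v x) $ i\<bar> \<le> C * e"
proof
  let ?C = "1 + (\<Sum>i\<in>UNIV. \<Sum>j\<in>UNIV. \<bar>A $ i $ j\<bar>)"
  show "1 \<le> ?C" by (simp add: sum_nonneg)
  fix x :: "real ^ 'n" and e i
  assume x: "\<And>j. \<bar>x $ j\<bar> \<le> e"
  have e: "0 \<le> e" using x[of undefined] by linarith
  have "\<bar>(A *v x) $ i\<bar> \<le> (\<Sum>j\<in>UNIV. \<bar>A $ i $ j * x $ j\<bar>)"
    unfolding matrix_vector_mult_def by (simp add: sum_abs)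
  also have "\<dots> \<le> (\<Sum>j\<in>UNIV. \<bar>A $ i $ j\<bar> * e)"
    using x by (intro sum_mono) (auto simp: abs_mult intro: mult_left_mono)
  also have "\<dots> = (\<Sum>j\<in>UNIV. \<bar>A $ i $ j\<bar>) * e" by (simp add: sum_distrib_right)
  also have "(\<Sum>j\<in>UNIV. \<bar>A $ i $ j\<bar>) \<le> (\<Sum>i\<in>UNIV. \<Sum>j\<in>UNIV. \<bar>A $ i $ j\<bar>)"
    by (rule member_le_sum) (auto intro: sum_nonneg)
  then have "(\<Sum>j\<in>UNIV. \<bar>A $ i $ j\<bar>) * e \<le> ?C * e" using e by (intro mult_right_mono) auto
  finally show "\<bar>(A *v x) $ i\<bar> \<le> ?C * e" .
qed

lemma int_matrix_vector_Ints:
  "(map_matrix real_of_int A *v (\<chi> j. real_of_int (p j))) $ i = real_of_int (\<Sum>j\<in>UNIV. A $ i $ j * p j)"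
  by (simp add: matrix_vector_mult_def map_matrix_def)

section \<open>Upper bound\<close>

text \<open>The matrix \<open>M\<close> is an integral multiple of the inverse of \<open>P\<close>,
  with factor \<open>q\<close>; both are integral, so both respect congruence modulo the
  lattice.\<close>

locale int_diagonalization =
  fixes T P M :: "int ^ 'n::finite ^ 'n" and q :: int and \<delta> :: "'n \<Rightarrow> real"
  assumes PT: "(map_matrix real_of_int P *v (map_matrix real_of_int T *v x)) $ k
      = \<delta> k * (map_matrix real_of_int P *v x) $ k"
    and PM: "map_matrix real_of_int P *v (map_matrix real_of_int M *v x) = of_int q *\<^sub>R x"
    and MP: "map_matrix real_of_int M *v (map_matrix real_of_int P *v x) = of_int q *\<^sub>R x"
    and q: "q \<noteq> 0"
    and \<delta>: "1 < \<delta> k"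
begin

abbreviation "PR \<equiv> map_matrix real_of_int P"
abbreviation "MR \<equiv> map_matrix real_of_int M"
abbreviation "TR \<equiv> map_matrix real_of_int T"

lemma P_funpow: "(PR *v (((*v) TR ^^ n) x)) $ k = \<delta> k ^ n * (PR *v x) $ k"
  by (induction n) (simp_all add: PT)

definition b :: "'n \<Rightarrow> real" where "b k = ln (\<delta> k)"

lemma b_pos: "0 < b k" unfolding b_def using \<delta> by (intro ln_gt_zero) auto

lemma exp_b: "exp (real n * b k) = \<delta> k ^ n"
proof -
  have "0 < \<delta> k" using \<delta>[of k] by linarith
  then show ?thesis unfolding b_def by (simp add: exp_of_nat_mult)
qed

lemma abs_q: "1 \<le> \<bar>real_of_int q\<bar>"
  using q by linarith

text \<open>For a fixed \<open>i\<close>, the \<open>n\<close>-th target is covered by boxes of side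
  \<open>exp (- n * (b i + L))\<close> in the coordinates \<open>P x\<close>. Their number is at
  most a constant times \<open>exp (n * rate b L (b i))\<close>, so the \<open>s\<close>-sums decay
  geometrically. Negative \<open>L\<close> is allowed as long as all \<open>b k + L\<close> are
  positive.\<close>

lemma upper_bound:
  assumes bL: "\<And>k. 0 < b k + L" and "0 < s" and s: "rate b L (b i) < s * (b i + L)"
    and W: "W \<subseteq> {x. \<exists>\<^sub>\<infinity>n. (torus_map T ^^ n) x \<in> cball a (exp (- real n * L))}"
  shows "hausdorff_measure s W = 0"
proof -
  obtain \<alpha> where \<alpha>: "a = abs_torus \<alpha>" by (rule abs_torus_representative) blast
  obtain CP where CP: "1 \<le> CP" "\<And>x e i. (\<And>j. \<bar>x $ j\<bar> \<le> e) \<Longrightarrow> \<bar>(PR *v x) $ i\<bar> \<le> CP * e"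
    using matrix_vector_bound[of PR] by blast
  obtain CM where CM: "1 \<le> CM" "\<And>x e i. (\<And>j. \<bar>x $ j\<bar> \<le> e) \<Longrightarrow> \<bar>(MR *v x) $ i\<bar> \<le> CM * e"
    using matrix_vector_bound[of MR] by blast
  define r where "r n = exp (- real n * (b i + L))" for n
  \<comment> \<open>Contains the \<open>k\<close>-th coordinate of \<open>P x\<close> for a
    representative \<open>x\<close> in the unit cube whose \<open>n\<close>-th iterate lies in the
    target.\<close>
  define near where "near n k = {y. \<bar>y\<bar> \<le> CP \<and>
    (\<exists>p::int. \<bar>exp (real n * b k) * y - (PR *v \<alpha>) $ k - of_int p\<bar> \<le> CP * exp (- real n * L))}" for n k
  define cov where "cov C n k X \<longleftrightarrow> finite X \<and> real (card X) \<le> C * exp (real n * min (b i + L) (max (b i) (b k)))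
    \<and> near n k \<subseteq> (\<Union>t\<in>X. {t..t + r n})" for C n k and X :: "real set"
  have "\<exists>C>0. \<forall>n. \<exists>X. cov C n k X" for k
    unfolding cov_def near_def r_def
    using CP(1) b_pos[of k] bL[of i] bL[of k] by (intro cover_near_lattice) auto
  then have "\<forall>k. \<exists>C. 0 < C \<and> (\<forall>n. \<exists>X. cov C n k X)" by blast
  from choice[OF this] obtain C where C: "\<And>k. 0 < C k" "\<And>k n. \<exists>X. cov (C k) n k X" by blast
  define X where "X n k = (SOME X. cov (C k) n k X)" for n k
  have X: "cov (C k) n k (X n k)" for n k
    unfolding X_def by (rule someI_ex) (rule C(2))
  \<comment> \<open>The projection to the torus of the set of \<open>x\<close> for which
    \<open>P x\<close> lies in the box with corner \<open>t\<close> and side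
    \<open>r n\<close>.\<close>
  define U where "U n t = abs_torus ` {x. \<forall>k. t $ k \<le> (PR *v x) $ k \<and> (PR *v x) $ k \<le> t $ k + r n}" for n t
  define I where "I n = {t :: real^'n. \<forall>k. t $ k \<in> X n k}" for n
  have Xfin: "finite (X n k)" for n k using X unfolding cov_def by blast
  have I: "finite (I n)" "card (I n) = (\<Prod>k\<in>UNIV. card (X n k))" for n
    unfolding I_def using finite_card_cart[of "X n"] Xfin by blast+
  define V where "V n = {z. (torus_map T ^^ n) z \<in> cball a (exp (- real n * L))}" for n
  have W': "W \<subseteq> {x. \<exists>\<^sub>\<infinity>n. x \<in> V n}" using W by (simp add: V_def)
  have cover: "V n \<subseteq> \<Union> (U n ` I n)" for n
  proof
    fix z assume z: "z \<in> V n"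
    obtain x where x: "z = abs_torus x" "\<And>i. \<bar>x $ i\<bar> \<le> 1"
      by (rule abs_torus_representative[of z]) blast
    let ?e = "exp (- real n * L)" and ?u = "((*v) TR ^^ n) x"
    have "dist (abs_torus ?u) (abs_torus \<alpha>) \<le> ?e"
      using z unfolding V_def x(1) \<alpha> by (simp add: torus_map_funpow_abs dist_commute)
    then have "\<forall>i. \<exists>p::int. \<bar>?u $ i - \<alpha> $ i - of_int p\<bar> \<le> ?e"
      unfolding dist_abs_torus_le_iff nint_dist_le_iff .
    from choice[OF this] obtain p :: "'n \<Rightarrow> int" where p: "\<And>i. \<bar>?u $ i - \<alpha> $ i - of_int (p i)\<bar> \<le> ?e"
      by blast
    have near: "(PR *v x) $ k \<in> near n k" for k
    proof -
      let ?p = "\<chi> j. real_of_int (p j)"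
      have "\<bar>(PR *v (?u - \<alpha> - ?p)) $ k\<bar> \<le> CP * ?e"
        using p by (intro CP(2)) simp
      \<comment> \<open>As \<open>P\<close> is integral, it sends the approximating integer vector
        \<open>p\<close> to an integer vector.\<close>
      then have "\<bar>(PR *v ?u) $ k - (PR *v \<alpha>) $ k - of_int (\<Sum>j\<in>UNIV. P $ k $ j * p j)\<bar> \<le> CP * ?e"
        by (simp only: matrix_vector_mult_diff_distrib vector_minus_component int_matrix_vector_Ints)
      moreover have "\<bar>(PR *v x) $ k\<bar> \<le> CP * 1" by (rule CP(2)) (rule x(2))
      ultimately show ?thesis unfolding near_def P_funpow exp_b mult_1_right by blast
    qed
    have "\<exists>t. t \<in> X n k \<and> t \<le> (PR *v x) $ k \<and> (PR *v x) $ k \<le> t + r n" for k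
      using subsetD[OF conjunct2[OF conjunct2[OF X[of k n, unfolded cov_def]]] near[of k]] by auto
    then have "\<forall>k. \<exists>t. t \<in> X n k \<and> t \<le> (PR *v x) $ k \<and> (PR *v x) $ k \<le> t + r n" by blast
    from choice[OF this] obtain t where
      t: "\<And>k. t k \<in> X n k \<and> t k \<le> (PR *v x) $ k \<and> (PR *v x) $ k \<le> t k + r n" by blast
    have "vec_lambda t \<in> I n" "z \<in> U n (vec_lambda t)"
      unfolding I_def U_def x(1) using t by auto
    then show "z \<in> \<Union> (U n ` I n)" by blast
  qed
  have small: "dist x y \<le> CM * r n" if B: "B \<in> U n ` I n" "x \<in> B" "y \<in> B" for n B x y
  proof -
    obtain t where t: "B = U n t" using B(1) by blast
    obtain u where u: "x = abs_torus u" "\<forall>k. t $ k \<le> (PR *v u) $ k \<and> (PR *v u) $ k \<le> t $ k + r n"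
      using B(2) unfolding t U_def by blast
    obtain v where v: "y = abs_torus v" "\<forall>k. t $ k \<le> (PR *v v) $ k \<and> (PR *v v) $ k \<le> t $ k + r n"
      using B(3) unfolding t U_def by blast
    have "\<bar>(PR *v (u - v)) $ k\<bar> \<le> r n" for k
      using u(2)[rule_format, of k] v(2)[rule_format, of k]
      by (simp add: matrix_vector_mult_diff_distrib abs_le_iff)
    \<comment> \<open>\<open>M\<close> undoes \<open>P\<close> up to the factor \<open>q\<close>,
      and \<open>\<bar>q\<bar> \<ge> 1\<close>, so dividing by it costs nothing.\<close>
    then have "\<bar>(MR *v (PR *v (u - v))) $ i\<bar> \<le> CM * r n" for i by (rule CM(2))
    then have *: "\<bar>of_int q\<bar> * \<bar>u $ i - v $ i\<bar> \<le> CM * r n" for i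
      unfolding MP by (simp add: abs_mult)
    have "nint_dist (u $ i - v $ i) \<le> CM * r n" for i
    proof -
      have "nint_dist (u $ i - v $ i) \<le> \<bar>u $ i - v $ i\<bar>"
        using nint_dist_le[of "u $ i - v $ i" 0] by simp
      also have "\<dots> \<le> \<bar>of_int q\<bar> * \<bar>u $ i - v $ i\<bar>"
        using mult_right_mono[OF abs_q, of "\<bar>u $ i - v $ i\<bar>"] by simp
      finally show ?thesis using * by (rule order_trans)
    qed
    then show ?thesis unfolding u(1) v(1) dist_abs_torus_le_iff by blast
  qed
  have exp_n: "exp (real n * y) = exp y ^ n" for n y by (rule exp_of_nat_mult)
  have r_eq: "r n = exp (- (b i + L)) ^ n" for n
    unfolding r_def exp_n[symmetric] by (simp add: algebra_simps)
  have r0: "r \<longlonglongrightarrow> 0"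
    unfolding r_eq[abs_def] using bL[of i] by (intro LIMSEQ_power_zero) simp
  have number: "real (card (U n ` I n)) * (CM * r n) powr s
      \<le> ((\<Prod>k\<in>UNIV. C k) * CM powr s) * exp (rate b L (b i) - s * (b i + L)) ^ n" for n
  proof -
    have "real (card (U n ` I n)) \<le> real (card (I n))" using card_image_le[OF I(1)] by simp
    also have "\<dots> = (\<Prod>k\<in>UNIV. real (card (X n k)))" by (simp add: I(2))
    also have "\<dots> \<le> (\<Prod>k\<in>UNIV. C k * exp (real n * min (b i + L) (max (b i) (b k))))"
      using X unfolding cov_def by (intro prod_mono) auto
    also have "\<dots> = (\<Prod>k\<in>UNIV. C k) * exp (real n * rate b L (b i))"
      unfolding rate_def by (simp add: prod.distrib exp_sum sum_distrib_left)
    finally have 1: "real (card (U n ` I n)) \<le> (\<Prod>k\<in>UNIV. C k) * exp (real n * rate b L (b i))" .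
    have 2: "(CM * r n) powr s = CM powr s * exp (- (real n * (s * (b i + L))))"
      using CM(1) by (simp add: r_def powr_mult exp_powr_real mult_ac)
    have "real (card (U n ` I n)) * (CM * r n) powr s
       \<le> ((\<Prod>k\<in>UNIV. C k) * exp (real n * rate b L (b i))) * (CM powr s * exp (- (real n * (s * (b i + L)))))"
      unfolding 2 by (rule mult_right_mono[OF 1]) simp
    also have "\<dots> = ((\<Prod>k\<in>UNIV. C k) * CM powr s) *
        (exp (real n * rate b L (b i)) * exp (- (real n * (s * (b i + L)))))"
      by (simp only: mult_ac)
    also have "exp (real n * rate b L (b i)) * exp (- (real n * (s * (b i + L))))
        = exp (rate b L (b i) - s * (b i + L)) ^ n"
      unfolding exp_n[symmetric] exp_add[symmetric] by (simp add: right_diff_distrib)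
    finally show ?thesis .
  qed
  show ?thesis
  proof (rule hausdorff_measure_limsup_eq_0[OF \<open>0 < s\<close> W' _ cover small _ _ number])
    show "finite (U n ` I n)" for n using I by blast
    show "(\<lambda>n. CM * r n) \<longlonglongrightarrow> 0" using tendsto_mult_right_zero[OF r0] .
    show "0 \<le> CM * r n" for n using CM(1) by (simp add: r_def)
    show "summable (\<lambda>n. ((\<Prod>k\<in>UNIV. C k) * CM powr s) * exp (rate b L (b i) - s * (b i + L)) ^ n)"
      using s by (intro summable_mult summable_geometric) simp
  qed
qed

end

section \<open>Products of Cantor sets\<close>

lemma compact_vec_box:
  fixes A :: "'n::finite \<Rightarrow> real set"
  assumes "\<And>k. compact (A k)"
  shows "compact {y::real^'n. \<forall>k. y $ k \<in> A k}"
proof -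
  have "closed {y::real^'n. y $ k \<in> A k}" for k
    using continuous_closed_vimage[OF compact_imp_closed[OF assms[of k]], of "\<lambda>y::real^'n. y $ k"]
    by (simp add: vimage_def)
  then have "closed {y::real^'n. \<forall>k. y $ k \<in> A k}" by (rule closed_Collect_all)
  moreover have "\<exists>B. \<forall>y\<in>A k. \<bar>y\<bar> \<le> B" for k
    using compact_imp_bounded[OF assms[of k]] by (simp add: bounded_iff)
  then have "\<forall>k. \<exists>B. \<forall>y\<in>A k. \<bar>y\<bar> \<le> B" by blast
  from choice[OF this] obtain B where B: "\<And>k y. y \<in> A k \<Longrightarrow> \<bar>y\<bar> \<le> B k" by blast
  have "norm y \<le> (\<Sum>k\<in>UNIV. B k)" if "\<forall>k. y $ k \<in> A k" for y :: "real^'n"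
    using norm_le_l1_cart[of y] sum_mono[of UNIV "\<lambda>k. \<bar>y $ k\<bar>" B] B that by force
  then have "bounded {y::real^'n. \<forall>k. y $ k \<in> A k}" by (auto simp: bounded_iff)
  ultimately show ?thesis by (simp add: compact_eq_bounded_closed)
qed

text \<open>One Cantor scheme per coordinate, all refined at the same times \<open>N j\<close>. The
  assumption \<open>sep\<close> lets at least four lattice steps of the next level fit into an
  interval of the current one.\<close>

locale cantor_system =
  fixes b \<alpha> :: "'n::finite \<Rightarrow> real" and L c :: real and N :: "nat \<Rightarrow> nat"
  assumes b_pos: "0 < b k" and L: "0 \<le> L" and c: "0 < c" "c < 1"
    and N0: "N 0 = 0" and N_less: "N j < N (Suc j)"
    and sep: "4 \<le> c * exp (- real (N j) * L) * exp ((real (N (Suc j)) - real (N j)) * b k)"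
begin

definition w :: "'n \<Rightarrow> nat \<Rightarrow> real" where "w k j = exp (- (real (N j) * b k))"

definition \<rho> :: "'n \<Rightarrow> nat \<Rightarrow> real" where "\<rho> k j = c * exp (- real (N j) * L) * w k j"

text \<open>One less than the number of steps that fit, leaving room for the rounding. Only positive
  \<open>j\<close> are used.\<close>

definition m :: "'n \<Rightarrow> nat \<Rightarrow> nat" where "m k j = nat \<lfloor>\<rho> k (j - 1) / w k j\<rfloor> - 1"

text \<open>A lower bound, common to all coordinates, for the part of the unit density that survives
  the first \<open>j\<close> refinements.\<close>

definition G :: "nat \<Rightarrow> real" where "G j = (\<Prod>i<j. c / 2 * exp (- real (N i) * L))"

abbreviation A :: "'n \<Rightarrow> nat \<Rightarrow> real set" where "A k \<equiv> cantor_pts (w k) (m k) (\<alpha> k)"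

lemma w_pos: "0 < w k j" by (simp add: w_def)

lemma G_pos: "0 < G j" unfolding G_def using c by (intro prod_pos) simp

lemma ratio: "4 \<le> \<rho> k j / w k (Suc j)"
proof -
  have "\<rho> k j / w k (Suc j) = c * exp (- real (N j) * L) * (w k j / w k (Suc j))"
    by (simp add: \<rho>_def)
  also have "w k j / w k (Suc j) = exp ((real (N (Suc j)) - real (N j)) * b k)"
    unfolding w_def exp_diff[symmetric] by (simp add: algebra_simps)
  finally show ?thesis using sep by simp
qed

lemma m_Suc: "0 < m k (Suc j)" "real (m k (Suc j)) + 1 \<le> \<rho> k j / w k (Suc j)"
  "\<rho> k j / w k (Suc j) \<le> 2 * real (m k (Suc j))"
  using ratio[of k j] unfolding m_def by (simp_all; linarith)+

lemma \<rho>_less: "0 \<le> \<rho> k j" "\<rho> k j < w k j"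
proof -
  show "0 \<le> \<rho> k j" using c by (simp add: \<rho>_def w_def)
  have "exp (- real (N j) * L) \<le> 1" using L by simp
  then have "c * exp (- real (N j) * L) \<le> c * 1"
    using c by (intro mult_left_mono) auto
  then have "c * exp (- real (N j) * L) < 1" using c by linarith
  then show "\<rho> k j < w k j" unfolding \<rho>_def using w_pos[of k j] mult_strict_right_mono by fastforce
qed

lemma cantor_scheme: "cantor_scheme (w k) (\<rho> k) (m k)"
  using m_Suc \<rho>_less w_pos
  by unfold_locales (auto simp: pos_le_divide_eq)

text \<open>One refinement multiplies \<open>card (A k j) * w k j\<close> by
  \<open>m k (Suc j) * w k (Suc j) / w k j\<close>, which is at least
  \<open>\<rho> k j / (2 * w k j)\<close>, the next factor of \<open>G\<close>.\<close>

lemma G_le: "G j \<le> real (card (A k j)) * w k j"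
proof (induction j)
  case 0
  then show ?case by (simp add: G_def w_def N0)
next
  case (Suc j)
  interpret cantor_scheme "w k" "\<rho> k" "m k" "\<alpha> k" by (rule cantor_scheme)
  have "G (Suc j) = G j * (c / 2 * exp (- real (N j) * L))" by (simp add: G_def)
  also have "\<dots> \<le> (real (card (A k j)) * w k j) * (c / 2 * exp (- real (N j) * L))"
    using Suc.IH c by (intro mult_right_mono) auto
  also have "\<dots> = real (card (A k j)) * (\<rho> k j / 2)" by (simp add: \<rho>_def)
  also have "\<dots> \<le> real (card (A k j)) * (real (m k (Suc j)) * w k (Suc j))"
    using m_Suc(3)[of k j] w_pos[of k "Suc j"]
    by (intro mult_left_mono) (auto simp: pos_divide_le_eq)
  also have "\<dots> = real (card (A k (Suc j))) * w k (Suc j)"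
    unfolding card_pts_Suc by simp
  finally show ?case .
qed

lemma card_A_Int_le:
  assumes "j \<le> J" "0 < r"
  shows "real (card (A k J \<inter> {t..t + r})) \<le> 4 * max r (w k j) / G j * real (card (A k J))"
proof -
  interpret cantor_scheme "w k" "\<rho> k" "m k" "\<alpha> k" by (rule cantor_scheme)
  have pos: "0 < real (card (A k j))" using card_pts_pos by simp
  have "(r / w k j + 3) / real (card (A k j)) = (r + 3 * w k j) / (real (card (A k j)) * w k j)"
    using w_pos[of k j] pos by (simp add: field_simps)
  also have "\<dots> \<le> (4 * max r (w k j)) / G j"
    using assms(2) w_pos[of k j] G_pos[of j] G_le[of j k] by (intro frac_le) auto
  finally have "(r / w k j + 3) / real (card (A k j)) \<le> 4 * max r (w k j) / G j" .
  then show ?thesis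
    using card_pts_Int_le[OF assms(1), of r t] assms(2)
    by (meson less_imp_le mult_right_mono of_nat_0_le_iff order_trans)
qed

definition K :: "nat \<Rightarrow> (real^'n) set" where
  "K J = {y. \<forall>k. y $ k \<in> (\<Union>x\<in>A k J. {x..x + \<rho> k J})}"

definition F :: "nat \<Rightarrow> (real^'n) set" where "F J = {y. \<forall>k. y $ k \<in> A k J}"

lemma finite_A: "finite (A k J)"
  by (rule cantor_scheme.finite_pts[OF cantor_scheme])

lemma compact_K: "compact (K J)"
  unfolding K_def by (intro compact_vec_box compact_UN finite_A) auto

lemma decseq_K: "decseq K"
  unfolding K_def using cantor_scheme.pts_intervals_decreasing[OF cantor_scheme]
  by (intro decseq_SucI) blast

lemma F_facts: "finite (F J)" "F J \<noteq> {}" "F J \<subseteq> K J" "card (F J) = (\<Prod>k\<in>UNIV. card (A k J))"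
proof -
  show "finite (F J)" and card: "card (F J) = (\<Prod>k\<in>UNIV. card (A k J))"
    unfolding F_def using finite_card_cart[of "\<lambda>k. A k J"] finite_A by blast+
  have "card (F J) > 0"
    unfolding card using cantor_scheme.card_pts_pos[OF cantor_scheme] by (intro prod_pos) auto
  then show "F J \<noteq> {}" by auto
  show "F J \<subseteq> K J" unfolding F_def K_def using \<rho>_less(1) by fastforce
qed

lemma N_ge: "j \<le> N j"
  by (induction j) (use N_less Suc_leI le_trans in \<open>auto simp: Suc_le_eq intro: le_less_trans\<close>)

text \<open>The side \<open>r\<close> is compared with levels \<open>j\<close> and
  \<open>Suc j\<close>. In each coordinate level \<open>j\<close> bounds the mass by
  \<open>exp (- min (N j * b k) x)\<close> and level \<open>Suc j\<close> by
  \<open>exp (- (x - N j * L))\<close>, up to \<open>G\<close>; the better bound produces the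
  maximum in the exponent estimate. The losses from \<open>G\<close> lower the exponent by
  \<open>CARD('n) * \<epsilon> / \<mu>\<close>.\<close>

lemma card_F_box_le:
  assumes "0 < \<epsilon>" and G: "\<And>j. exp (- \<epsilon> * real (N j)) \<le> G j"
    and s0: "\<And>i. s0 * (b i + L) \<le> rate b L (b i)" and \<mu>: "0 < \<mu>" "\<And>k. \<mu> \<le> b k"
    and r: "0 < r" "r < 1"
  shows "\<forall>\<^sub>F J in sequentially. \<forall>t::real^'n. real (card {y \<in> F J. \<forall>k. t $ k \<le> y $ k \<and> y $ k \<le> t $ k + r})
    \<le> (8 / c) ^ CARD('n) * r powr (s0 - real CARD('n) * \<epsilon> / \<mu>) * real (card (F J))"
proof -
  define x where "x = - ln r"
  have x: "0 < x" "r = exp (- x)" using r by (simp_all add: x_def)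
  have "\<exists>j. x \<le> real (N j) * \<mu>"
  proof
    have "x \<le> real (nat \<lceil>x / \<mu>\<rceil>) * \<mu>"
      using \<mu>(1) real_nat_ceiling_ge[of "x / \<mu>"] by (simp add: pos_divide_le_eq)
    also have "\<dots> \<le> real (N (nat \<lceil>x / \<mu>\<rceil>)) * \<mu>"
      using N_ge \<mu>(1) by (intro mult_right_mono) auto
    finally show "x \<le> real (N (nat \<lceil>x / \<mu>\<rceil>)) * \<mu>" .
  qed
  \<comment> \<open>Reaching \<open>x\<close> makes \<open>w k j' \<le> r\<close> in every
    coordinate; minimality gives \<open>N j < x / \<mu>\<close> for the preceding level, which
    controls the loss \<open>?e\<close>.\<close>
  define j' where "j' = (LEAST j. x \<le> real (N j) * \<mu>)"
  have j': "x \<le> real (N j') * \<mu>" unfolding j'_def by (rule LeastI_ex) fact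
  have "j' \<noteq> 0" using j' x(1) N0 by (intro notI) simp
  then obtain j where j: "j' = Suc j" using not0_implies_Suc by blast
  have Nj: "real (N j) * \<mu> < x"
    using not_less_Least[of j "\<lambda>j. x \<le> real (N j) * \<mu>"] j unfolding j'_def by simp
  let ?e = "exp (\<epsilon> * real (N j))"
  let ?max = "\<lambda>k. max (min (real (N j) * b k) x) (x - real (N j) * L)"
  have eG: "1 / G j \<le> ?e"
  proof -
    have "1 / G j \<le> 1 / exp (- \<epsilon> * real (N j))"
      using G[of j] G_pos[of j] by (intro divide_left_mono) auto
    then show ?thesis by (simp add: exp_minus field_simps)
  qed
  have factor: "real (card (A k J \<inter> {t..t + r})) \<le> 8 / c * ?e * exp (- ?max k) * real (card (A k J))"
    if J: "Suc j \<le> J" for J k t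
  proof -
    \<comment> \<open>The bound from level \<open>j\<close>.\<close>
    have "max r (w k j) = exp (- min (real (N j) * b k) x)"
      unfolding x(2) w_def by (auto simp: max_def min_def)
    then have "4 * max r (w k j) / G j = 4 * (1 / G j) * exp (- min (real (N j) * b k) x)" by simp
    also have "\<dots> \<le> 8 / c * ?e * exp (- min (real (N j) * b k) x)"
      using eG c G_pos[of j] by (intro mult_right_mono mult_mono) (auto simp: field_simps)
    finally have 1: "real (card (A k J \<inter> {t..t + r}))
        \<le> 8 / c * ?e * exp (- min (real (N j) * b k) x) * real (card (A k J))"
      using card_A_Int_le[of j J r k t] J r by (meson Suc_leD mult_right_mono of_nat_0_le_iff order_trans)
    \<comment> \<open>The bound from level \<open>Suc j\<close>: points are now finer than
      \<open>r\<close>, but the last factor of \<open>G (Suc j)\<close> costs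
      \<open>exp (N j * L)\<close>.\<close>
    have "x \<le> real (N (Suc j)) * b k"
      using j' \<mu>(2)[of k] mult_left_mono[of \<mu> "b k" "real (N (Suc j))"] unfolding j by simp
    then have "w k (Suc j) \<le> r" unfolding x(2) w_def by simp
    then have "4 * max r (w k (Suc j)) / G (Suc j) = 4 * r / (G j * (c / 2 * exp (- real (N j) * L)))"
      by (simp add: max_absorb1 G_def)
    also have "\<dots> = 8 / c * (1 / G j) * (r / exp (- real (N j) * L))"
      using c by (simp add: field_simps)
    also have "r / exp (- real (N j) * L) = exp (- (x - real (N j) * L))"
      unfolding x(2) exp_diff[symmetric] by (simp add: algebra_simps)
    also have "8 / c * (1 / G j) * \<dots> \<le> 8 / c * ?e * exp (- (x - real (N j) * L))"
      using eG c by (intro mult_right_mono mult_left_mono) auto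
    finally have 2: "real (card (A k J \<inter> {t..t + r}))
        \<le> 8 / c * ?e * exp (- (x - real (N j) * L)) * real (card (A k J))"
      using card_A_Int_le[of "Suc j" J r k t] J r by (meson mult_right_mono of_nat_0_le_iff order_trans)
    show ?thesis
    proof (cases "min (real (N j) * b k) x \<le> x - real (N j) * L")
      case True then show ?thesis using 2 by (simp add: max_absorb2)
    next
      case False then show ?thesis using 1 by (simp add: max_absorb1)
    qed
  qed
  have "real (card {y \<in> F J. \<forall>k. t $ k \<le> y $ k \<and> y $ k \<le> t $ k + r})
      \<le> (8 / c) ^ CARD('n) * r powr (s0 - real CARD('n) * \<epsilon> / \<mu>) * real (card (F J))"
    if J: "Suc j \<le> J" for J and t :: "real^'n"
  proof -
    have "{y \<in> F J. \<forall>k. t $ k \<le> y $ k \<and> y $ k \<le> t $ k + r}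
        = {y. \<forall>k. y $ k \<in> A k J \<inter> {t $ k..t $ k + r}}"
      by (auto simp: F_def)
    then have "real (card {y \<in> F J. \<forall>k. t $ k \<le> y $ k \<and> y $ k \<le> t $ k + r})
        = (\<Prod>k\<in>UNIV. real (card (A k J \<inter> {t $ k..t $ k + r})))"
      using finite_card_cart(2)[of "\<lambda>k. A k J \<inter> {t $ k..t $ k + r}"] finite_A by simp
    also have "\<dots> \<le> (\<Prod>k\<in>UNIV. 8 / c * ?e * exp (- ?max k) * real (card (A k J)))"
      using factor[OF J] by (intro prod_mono) auto
    also have "\<dots> = (8 / c) ^ CARD('n) * (?e ^ CARD('n) * exp (- (\<Sum>k\<in>UNIV. ?max k))) * real (card (F J))"
    proof -
      have "(\<Prod>k\<in>UNIV. exp (- ?max k)) = exp (- (\<Sum>k\<in>UNIV. ?max k))"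
        by (simp only: exp_sum[OF finite] sum_negf[symmetric])
      then show ?thesis
        by (simp only: prod.distrib F_facts(4) of_nat_prod prod_constant mult_ac)
    qed
    also have "\<dots> \<le> (8 / c) ^ CARD('n) * r powr (s0 - real CARD('n) * \<epsilon> / \<mu>) * real (card (F J))"
    proof (intro mult_right_mono mult_left_mono)
      have "?e ^ CARD('n) * exp (- (\<Sum>k\<in>UNIV. ?max k))
          = exp (real CARD('n) * (\<epsilon> * real (N j)) - (\<Sum>k\<in>UNIV. ?max k))"
        by (simp only: exp_of_nat_mult[symmetric] exp_add[symmetric] diff_conv_add_uminus)
      also have "\<dots> \<le> exp (real CARD('n) * (\<epsilon> * (x / \<mu>)) - s0 * x)"
      proof -
        have "s0 * x \<le> (\<Sum>k\<in>UNIV. ?max k)"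
          by (rule scale_le_sum_max_min_nat[OF s0 b_pos L x(1)])
        moreover have "real (N j) \<le> x / \<mu>" using Nj \<mu>(1) by (simp add: pos_le_divide_eq)
        then have "real CARD('n) * (\<epsilon> * real (N j)) \<le> real CARD('n) * (\<epsilon> * (x / \<mu>))"
          using \<open>0 < \<epsilon>\<close> by (intro mult_left_mono) auto
        ultimately show ?thesis by (subst exp_le_cancel_iff) linarith
      qed
      also have "\<dots> = r powr (s0 - real CARD('n) * \<epsilon> / \<mu>)"
        using r by (simp add: powr_def x_def algebra_simps)
      finally show "?e ^ CARD('n) * exp (- (\<Sum>k\<in>UNIV. ?max k)) \<le> r powr (s0 - real CARD('n) * \<epsilon> / \<mu>)" .
    qed (use c in auto)
    finally show ?thesis .
  qed
  then show ?thesis unfolding eventually_sequentially by blast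
qed

end

text \<open>The product bounding \<open>exp (- \<epsilon> * N j)\<close> involves only earlier
  times, so it is a fixed positive number when \<open>N j\<close> is chosen, and any large enough
  element of \<open>S\<close> will do.\<close>

lemma exists_sparse_sequence:
  fixes b :: "'n::finite \<Rightarrow> real"
  assumes S: "infinite S" and b: "\<And>k. 0 < b k" and c: "0 < c" and "0 < \<epsilon>"
  shows "\<exists>N::nat \<Rightarrow> nat. N 0 = 0 \<and> (\<forall>j. N (Suc j) \<in> S \<and> N j < N (Suc j) \<and>
    (\<forall>k. 4 \<le> c * exp (- real (N j) * L) * exp ((real (N (Suc j)) - real (N j)) * b k)) \<and>
    exp (- \<epsilon> * real (N j)) \<le> (\<Prod>i<j. c / 2 * exp (- real (N i) * L)))"
proof -
  \<comment> \<open>The recursion carries pairs: the current time and the product accumulated before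
    it.\<close>
  define P where "P j s \<longleftrightarrow> 0 < snd s \<and> exp (- \<epsilon> * real (fst s)) \<le> snd s \<and> (j = 0 \<longrightarrow> s = (0, 1))"
    for j :: nat and s :: "nat \<times> real"
  define Q where "Q s s' \<longleftrightarrow> fst s' \<in> S \<and> fst s < fst s' \<and>
      (\<forall>k. 4 \<le> c * exp (- real (fst s) * L) * exp ((real (fst s') - real (fst s)) * b k)) \<and>
      snd s' = snd s * (c / 2 * exp (- real (fst s) * L))"
    for s s' :: "nat \<times> real"
  have "\<exists>f. \<forall>j. P j (f j) \<and> Q (f j) (f (Suc j))"
  proof (rule dependent_nat_choice)
    show "\<exists>s. P 0 s" by (auto simp: P_def)
    fix s :: "nat \<times> real" and j assume "P j s"
    then have s: "0 < snd s" by (simp add: P_def)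
    define n where "n = fst s"
    define g where "g = snd s * (c / 2 * exp (- real n * L))"
    define a where "a = c * exp (- real n * L)"
    have ga: "0 < g" "0 < a" using s c by (simp_all add: g_def a_def)
    define Y where "Y = (\<Sum>k\<in>UNIV. 4 / (a * b k))"
    \<comment> \<open>The summands secure strict growth,
      \<open>exp (- \<epsilon> * n') \<le> g\<close>, and the separation in all coordinates; the
      last two use that \<open>exp z\<close> exceeds \<open>z\<close>.\<close>
    obtain n' where n': "n' \<in> S" "n + 1 + nat \<lceil>1 / (g * \<epsilon>)\<rceil> + nat \<lceil>Y\<rceil> \<le> n'"
      using S unfolding infinite_nat_iff_unbounded_le by blast
    have Y: "4 / (a * b k) \<le> Y" for k
      unfolding Y_def using ga b by (intro member_le_sum) (auto intro: less_imp_le)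
    have Y0: "0 \<le> Y" using order_trans[OF _ Y[of undefined]] ga b[of undefined] by simp
    have ge: "1 / (g * \<epsilon>) \<le> real n'" "Y \<le> real n' - real n"
      using n'(2) real_nat_ceiling_ge[of "1 / (g * \<epsilon>)"] real_nat_ceiling_ge[of Y] by linarith+
    have "1 / g \<le> real n' * \<epsilon>" using ge(1) ga \<open>0 < \<epsilon>\<close> by (simp add: field_simps)
    also have "\<dots> \<le> exp (\<epsilon> * real n')" 
      using exp_ge_add_one_self[of "\<epsilon> * real n'"] unfolding mult.commute[of "real n'"] by linarith
    finally have "exp (- \<epsilon> * real n') \<le> g" using ga by (simp add: exp_minus field_simps)
    moreover have "4 \<le> a * exp ((real n' - real n) * b k)" for k
    proof -
      have "4 / (a * b k) \<le> real n' - real n" using Y[of k] ge(2) by linarith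
      then have "4 / a \<le> (real n' - real n) * b k" using ga b[of k] by (simp add: field_simps)
      also have "\<dots> \<le> exp ((real n' - real n) * b k)"
        using exp_ge_add_one_self[of "(real n' - real n) * b k"] by linarith
      finally show ?thesis using ga by (simp add: field_simps)
    qed
    ultimately have "P (Suc j) (n', g)" "Q s (n', g)"
      using n' ga by (auto simp: P_def Q_def n_def g_def a_def)
    then show "\<exists>s'. P (Suc j) s' \<and> Q s s'" by blast
  qed
  then obtain f where f: "\<And>j. P j (f j)" "\<And>j. Q (f j) (f (Suc j))" by blast
  have "f 0 = (0, 1)" using f(1)[of 0] by (simp add: P_def)
  then have prod: "snd (f j) = (\<Prod>i<j. c / 2 * exp (- real (fst (f i)) * L))" for j
    using f(2) by (induction j) (simp_all add: Q_def)
  show ?thesis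
    using f \<open>f 0 = (0, 1)\<close> unfolding P_def Q_def prod
    by (intro exI[of _ "\<lambda>j. fst (f j)"]) auto
qed

section \<open>Lower bound\<close>

lemma hausdorff_measure_mono: "A \<subseteq> B \<Longrightarrow> hausdorff_measure s A \<le> hausdorff_measure s B"
  unfolding hausdorff_measure_def hausdorff_premeasure_def
  by (intro SUP_mono' INF_superset_mono) auto

context int_diagonalization
begin

text \<open>The map \<open>y \<mapsto> M y\<close> modulo one carries a product of Cantor sets,
  refined at times in \<open>S\<close>, into the target set. It is injective with controlled
  distortion on the initial box, so box counts for \<open>F J\<close> become counts for small sets
  on the torus.\<close>

lemma lower_bound:
  assumes L: "0 \<le> L" and "0 < s" and s: "\<And>i. s * (b i + L) < rate b L (b i)"
    and S: "infinite S" and \<psi>: "\<And>n. n \<in> S \<Longrightarrow> exp (- real n * L) \<le> \<psi> n"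
  shows "hausdorff_measure s {x. \<exists>\<^sub>\<infinity>n. (torus_map T ^^ n) x \<in> cball a (\<psi> n)} \<noteq> 0"
proof -
  obtain \<alpha> where \<alpha>: "a = abs_torus \<alpha>" by (rule abs_torus_representative) blast
  obtain CP where CP: "1 \<le> CP" "\<And>x e i. (\<And>j. \<bar>x $ j\<bar> \<le> e) \<Longrightarrow> \<bar>(PR *v x) $ i\<bar> \<le> CP * e"
    using matrix_vector_bound[of PR] by blast
  obtain CM where CM: "1 \<le> CM" "\<And>x e i. (\<And>j. \<bar>x $ j\<bar> \<le> e) \<Longrightarrow> \<bar>(MR *v x) $ i\<bar> \<le> CM * e"
    using matrix_vector_bound[of MR] by blast
  \<comment> \<open>With \<open>CM * c \<le> 1/2\<close>, differences of points of \<open>M\<close>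
    applied to the initial box stay within the range where torus distance is absolute value; also
    \<open>c < 1\<close> separates the intervals.\<close>
  define c where "c = min (1 / (2 * CM)) (1 / 2)"
  have c_bounds: "0 < c" "c < 1" "CM * c \<le> 1 / 2"
  proof -
    show "0 < c" "c < 1" using CM(1) by (auto simp: c_def)
    have "CM * c \<le> CM * (1 / (2 * CM))" using CM(1) by (intro mult_left_mono) (auto simp: c_def)
    then show "CM * c \<le> 1 / 2" using CM(1) by simp
  qed
  define s0 where "s0 = Min (range (\<lambda>i. rate b L (b i) / (b i + L)))"
  have bL: "0 < b i + L" for i using b_pos[of i] L by linarith
  have s0: "s0 * (b i + L) \<le> rate b L (b i)" for i
  proof -
    have "s0 \<le> rate b L (b i) / (b i + L)" unfolding s0_def by (intro Min_le) auto
    then show ?thesis using bL[of i] by (simp add: pos_le_divide_eq)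
  qed
  have "s < s0" unfolding s0_def using s bL by (subst Min_gr_iff) (auto simp: pos_less_divide_eq)
  define \<mu> where "\<mu> = Min (range b)"
  have \<mu>: "0 < \<mu>" "\<mu> \<le> b k" for k
    unfolding \<mu>_def using b_pos by (auto simp: Min_gr_iff)
  \<comment> \<open>Chosen so that the exponent lost to \<open>G\<close> is exactly
    \<open>s0 - s\<close>.\<close>
  define \<epsilon> where "\<epsilon> = (s0 - s) * \<mu> / real CARD('n)"
  have \<epsilon>: "0 < \<epsilon>" "s0 - real CARD('n) * \<epsilon> / \<mu> = s"
    using \<open>s < s0\<close> \<mu>(1) by (simp_all add: \<epsilon>_def)
  obtain N where N': "N 0 = 0 \<and> (\<forall>j. N (Suc j) \<in> S \<and> N j < N (Suc j) \<and>
    (\<forall>k. 4 \<le> c * exp (- real (N j) * L) * exp ((real (N (Suc j)) - real (N j)) * b k)) \<and>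
    exp (- \<epsilon> * real (N j)) \<le> (\<Prod>i<j. c / 2 * exp (- real (N i) * L)))"
    using exists_sparse_sequence[OF S b_pos c_bounds(1) \<epsilon>(1), of L] by (rule exE)
  have N: "N 0 = 0" "N (Suc j) \<in> S" "N j < N (Suc j)"
    "4 \<le> c * exp (- real (N j) * L) * exp ((real (N (Suc j)) - real (N j)) * b k)"
    "exp (- \<epsilon> * real (N j)) \<le> (\<Prod>i<j. c / 2 * exp (- real (N i) * L))" for j k
    using N' by (simp_all only: simp_thms)
  \<comment> \<open>The centres in the \<open>y\<close> coordinates: since
    \<open>P M y = q y\<close>, the point \<open>\<alpha>\<close> corresponds to
    \<open>P \<alpha> / q\<close>.\<close>
  define \<beta> where "\<beta> k = (PR *v \<alpha>) $ k / of_int q" for k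
  interpret cantor_system b \<beta> L c N
    by unfold_locales (fact b_pos L c_bounds N)+
  have G_ge: "exp (- \<epsilon> * real (N j)) \<le> G j" for j using N(5) by (simp add: G_def)
  define \<Phi> where "\<Phi> y = abs_torus (MR *v y)" for y
  have cont: "continuous_on X \<Phi>" for X
  proof (rule lipschitz_on_continuous_on)
    show "CM-lipschitz_on X \<Phi>"
    proof (rule lipschitz_onI)
      fix x y
      have "\<bar>(MR *v (x - y)) $ i\<bar> \<le> CM * dist x y" for i
        by (rule CM(2)) (simp add: dist_norm component_le_norm_cart[of "x - y", simplified])
      then have "nint_dist ((MR *v x) $ i - (MR *v y) $ i) \<le> CM * dist x y" for i
        using nint_dist_le[of "(MR *v x) $ i - (MR *v y) $ i" 0]
        by (auto simp: matrix_vector_mult_diff_distrib intro: order_trans)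
      then show "dist (\<Phi> x) (\<Phi> y) \<le> CM * dist x y"
        unfolding \<Phi>_def dist_abs_torus_le_iff by blast
    qed (use CM(1) in simp)
  qed
  have sub: "\<Phi> ` (\<Inter>J. K J) \<subseteq> {x. \<exists>\<^sub>\<infinity>n. (torus_map T ^^ n) x \<in> cball a (\<psi> n)}"
  proof -
    have hit: "(torus_map T ^^ n) (\<Phi> y) \<in> cball a (\<psi> n)" if y: "y \<in> K (Suc j)" and n: "n = N (Suc j)" for y j n
    proof -
      let ?e = "exp (- real n * L)"
      let ?u = "((*v) TR ^^ n) (MR *v y)"
      have "\<exists>p::int. \<bar>\<delta> k ^ n * y $ k - \<beta> k - of_int p\<bar> \<le> c * ?e" for k
      proof -
        obtain x where x: "x \<in> A k (Suc j)" "x \<le> y $ k" "y $ k \<le> x + \<rho> k (Suc j)"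
          using y unfolding K_def by (auto simp del: cantor_pts.simps)
        obtain p :: int where p: "x = w k (Suc j) * (\<beta> k + of_int p)"
          using cantor_scheme.pts_lattice[OF cantor_scheme x(1)] by blast
        have inv: "\<delta> k ^ n * w k (Suc j) = 1"
          unfolding exp_b[symmetric] w_def n by (simp add: exp_add[symmetric])
        have "0 \<le> \<delta> k ^ n" using \<delta>[of k] by simp
        then have "\<delta> k ^ n * x \<le> \<delta> k ^ n * y $ k" "\<delta> k ^ n * y $ k \<le> \<delta> k ^ n * (x + \<rho> k (Suc j))"
          using x by (auto intro: mult_left_mono)
        moreover have "\<delta> k ^ n * x = \<beta> k + of_int p"
          unfolding p using inv by (simp add: mult.assoc[symmetric])
        moreover have "\<delta> k ^ n * (x + \<rho> k (Suc j)) = \<delta> k ^ n * x + c * ?e * (\<delta> k ^ n * w k (Suc j))"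
          unfolding \<rho>_def n by (simp add: algebra_simps)
        ultimately have "\<bar>\<delta> k ^ n * y $ k - \<beta> k - of_int p\<bar> \<le> c * ?e"
          unfolding inv by linarith
        then show ?thesis by blast
      qed
      then have "\<forall>k. \<exists>p::int. \<bar>\<delta> k ^ n * y $ k - \<beta> k - of_int p\<bar> \<le> c * ?e" by blast
      from choice[OF this] obtain p :: "'n \<Rightarrow> int"
        where p: "\<And>k. \<bar>\<delta> k ^ n * y $ k - \<beta> k - of_int (p k)\<bar> \<le> c * ?e" by blast
      let ?p = "\<chi> k. real_of_int (p k)"
      let ?d = "\<chi> k. \<delta> k ^ n * y $ k - \<beta> k - of_int (p k)"
      \<comment> \<open>Both sides carry the factor \<open>q\<close>. Applying \<open>M\<close>
        multiplies the left side by \<open>q\<close> again, so cancelling leaves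
        \<open>?u - \<alpha>\<close> as an integer vector plus the small error
        \<open>M *v ?d\<close>.\<close>
      have "PR *v (?u - \<alpha>) = of_int q *\<^sub>R (?p + ?d)"
        using q unfolding matrix_vector_mult_diff_distrib
        by (simp add: vec_eq_iff P_funpow PM \<beta>_def algebra_simps)
      then have "MR *v (PR *v (?u - \<alpha>)) = of_int q *\<^sub>R (MR *v (?p + ?d))"
        by (simp add: matrix_vector_mult_scaleR)
      then have ud: "?u - \<alpha> = MR *v ?p + MR *v ?d"
        unfolding MP using q by (simp add: matrix_vector_right_distrib)
      have "nint_dist (?u $ i - \<alpha> $ i) \<le> \<psi> n" for i
      proof -
        have "?u $ i - \<alpha> $ i - of_int (\<Sum>j\<in>UNIV. M $ i $ j * p j) = (MR *v ?d) $ i"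
          using arg_cong[OF ud, of "\<lambda>v. v $ i"]
          unfolding vector_minus_component vector_add_component int_matrix_vector_Ints by linarith
        moreover have "\<bar>(MR *v ?d) $ i\<bar> \<le> CM * (c * ?e)" using p by (intro CM(2)) simp
        moreover have "CM * (c * ?e) \<le> 1 * ?e"
          unfolding mult.assoc[symmetric] using c_bounds(3) by (intro mult_right_mono) auto
        moreover have "?e \<le> \<psi> n" using \<psi> N(2) n by blast
        ultimately have "\<bar>?u $ i - \<alpha> $ i - of_int (\<Sum>j\<in>UNIV. M $ i $ j * p j)\<bar> \<le> \<psi> n"
          by linarith
        then show ?thesis unfolding nint_dist_le_iff by blast
      qed
      then show ?thesis
        unfolding \<Phi>_def torus_map_funpow_abs \<alpha> mem_cball
        by (subst dist_commute) (simp add: dist_abs_torus_le_iff)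
    qed
    show ?thesis
    proof
      fix z assume "z \<in> \<Phi> ` (\<Inter>J. K J)"
      then obtain y where y: "z = \<Phi> y" "\<And>J. y \<in> K J" by blast
      have "\<exists>n\<ge>m. (torus_map T ^^ n) z \<in> cball a (\<psi> n)" for m
        using hit[OF y(2) refl] N_ge[of "Suc m"] unfolding y(1) by (intro exI[of _ "N (Suc m)"]) auto
      then show "z \<in> {x. \<exists>\<^sub>\<infinity>n. (torus_map T ^^ n) x \<in> cball a (\<psi> n)}"
        by (simp add: INFM_nat_le)
    qed
  qed
  have "hausdorff_measure s (\<Phi> ` (\<Inter>J. K J)) \<noteq> 0"
  proof (rule mass_distribution_counting[where F = F and ?r0.0 = "1 / (2 * CP)"
        and C = "(8 / c) ^ CARD('n) * (2 * CP) powr s", OF compact_K decseq_K cont F_facts(1-3)])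
    fix U :: "'n torus set" and r :: real
    assume r: "0 < r" "r < 1 / (2 * CP)" and U: "\<And>x y. x \<in> U \<Longrightarrow> y \<in> U \<Longrightarrow> dist x y \<le> r"
    \<comment> \<open>The preimage of \<open>U\<close> in \<open>F J\<close> lies in a box of
      half-side \<open>CP * r\<close>; the bound on \<open>r\<close> makes
      \<open>r' < 1\<close>.\<close>
    define r' where "r' = 2 * CP * r"
    have r': "0 < r'" "r' < 1" using r CP(1) by (auto simp: r'_def field_simps)
    have r's: "r' powr s = (2 * CP) powr s * r powr s"
      unfolding r'_def using CP(1) r by (simp add: powr_mult)
    show "\<forall>\<^sub>F J in sequentially. real (card {y \<in> F J. \<Phi> y \<in> U})
        \<le> (8 / c) ^ CARD('n) * (2 * CP) powr s * r powr s * real (card (F J))"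
      using card_F_box_le[OF \<epsilon>(1) G_ge s0 \<mu> r']
    proof (rule eventually_mono)
      fix J
      assume J: "\<forall>t::real^'n. real (card {y \<in> F J. \<forall>k. t $ k \<le> y $ k \<and> y $ k \<le> t $ k + r'})
        \<le> (8 / c) ^ CARD('n) * r' powr (s0 - real CARD('n) * \<epsilon> / \<mu>) * real (card (F J))"
      show "real (card {y \<in> F J. \<Phi> y \<in> U})
        \<le> (8 / c) ^ CARD('n) * (2 * CP) powr s * r powr s * real (card (F J))"
      proof (cases "{y \<in> F J. \<Phi> y \<in> U} = {}")
        case True
        then show ?thesis unfolding True using c_bounds(1) by simp
      next
        case False
        then obtain y0 where y0: "y0 \<in> F J" "\<Phi> y0 \<in> U" by blast
        let ?t = "\<chi> k. y0 $ k - CP * r"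
        \<comment> \<open>At level 0 there is a single interval of length \<open>c\<close> in each
          coordinate, because \<open>N 0 = 0\<close>.\<close>
        have FK0: "\<beta> k \<le> y $ k \<and> y $ k \<le> \<beta> k + c" if "y \<in> F J" for y k
        proof -
          have "y \<in> K 0" using that F_facts(3)[of J] decseq_K by (auto simp: decseq_def)
          then show ?thesis unfolding K_def by (simp add: \<rho>_def w_def N0)
        qed
        have "{y \<in> F J. \<Phi> y \<in> U} \<subseteq> {y \<in> F J. \<forall>k. ?t $ k \<le> y $ k \<and> y $ k \<le> ?t $ k + r'}"
        proof (intro subsetI CollectI conjI allI)
          fix y k assume y: "y \<in> {y \<in> F J. \<Phi> y \<in> U}"
          then show "y \<in> F J" by blast
          have "\<bar>(y - y0) $ k\<bar> \<le> c" for k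
            using y FK0[of y k] FK0[OF y0(1), of k] by (simp add: abs_le_iff)
          then have "\<bar>(MR *v (y - y0)) $ i\<bar> \<le> CM * c" for i by (rule CM(2))
          then have half: "\<bar>(MR *v (y - y0)) $ i\<bar> \<le> 1 / 2" for i
            using c_bounds(3) by (rule order_trans)
          have "dist (\<Phi> y) (\<Phi> y0) \<le> r" using y y0 by (intro U) auto
          then have nd: "nint_dist ((MR *v y) $ i - (MR *v y0) $ i) \<le> r" for i
            unfolding \<Phi>_def dist_abs_torus_le_iff by blast
          have "\<bar>(MR *v (y - y0)) $ i\<bar> \<le> r" for i
            using nint_dist_eq_abs[OF half[of i]] nd[of i] by (simp add: matrix_vector_mult_diff_distrib)
          then have "\<bar>(PR *v (MR *v (y - y0))) $ k\<bar> \<le> CP * r" by (rule CP(2))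
          then have "\<bar>of_int q\<bar> * \<bar>y $ k - y0 $ k\<bar> \<le> CP * r"
            unfolding PM by (simp add: abs_mult)
          moreover have "\<bar>y $ k - y0 $ k\<bar> \<le> \<bar>of_int q\<bar> * \<bar>y $ k - y0 $ k\<bar>"
            using mult_right_mono[OF abs_q, of "\<bar>y $ k - y0 $ k\<bar>"] by simp
          ultimately have "\<bar>y $ k - y0 $ k\<bar> \<le> CP * r" by linarith
          then show "?t $ k \<le> y $ k" "y $ k \<le> ?t $ k + r'" by (auto simp: r'_def abs_le_iff)
        qed
        then have "card {y \<in> F J. \<Phi> y \<in> U} \<le> card {y \<in> F J. \<forall>k. ?t $ k \<le> y $ k \<and> y $ k \<le> ?t $ k + r'}"
          using F_facts(1) by (intro card_mono) auto
        then have "real (card {y \<in> F J. \<Phi> y \<in> U})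
            \<le> (8 / c) ^ CARD('n) * r' powr (s0 - real CARD('n) * \<epsilon> / \<mu>) * real (card (F J))"
          using J[rule_format, of ?t] by linarith
        then show ?thesis unfolding \<epsilon>(2) r's by (simp only: mult_ac)
      qed
    qed
  qed (use CP(1) c_bounds(1) \<open>0 < s\<close> in auto)
  then show ?thesis using hausdorff_measure_mono[OF sub, of s] by auto
qed

end

section \<open>Characteristic polynomials and the function theta\<close>

lemma det_map_of_int: "det (map_matrix real_of_int A) = real_of_int (det A)"
  by (simp add: det_def)

lemma of_int_matrix_mult:
  "map_matrix real_of_int (A ** B) = map_matrix real_of_int A ** map_matrix real_of_int B"
  by (simp add: vec_eq_iff matrix_matrix_mult_def)

text \<open>By Cramer's rule, the entries of \<open>det P\<close> times the inverse are determinants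
  of the integer matrices \<open>B k l\<close>, where column \<open>k\<close> of \<open>P\<close> is
  replaced by the \<open>l\<close>-th unit vector.\<close>

lemma integer_adjugate:
  fixes P :: "int ^ 'n::finite ^ 'n"
  assumes "det P \<noteq> 0"
  shows "\<exists>M. map_matrix real_of_int P ** map_matrix real_of_int M = mat (of_int (det P))"
proof -
  let ?P = "map_matrix real_of_int P"
  define B where "B k l = (\<chi> i j. if j = k then (if i = l then 1 else 0) else P $ i $ j)" for k l
  define M where "M = (\<chi> k l. det (B k l))"
  have "(?P *v (\<chi> k. of_int (M $ k $ l) / of_int (det P))) = axis l 1" for l
  proof -
    have "map_matrix real_of_int (B k l) = (\<chi> i j. if j = k then axis l 1 $ i else ?P $ i $ j)" for k
      by (simp add: vec_eq_iff B_def axis_def)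
    then have "(\<chi> k. of_int (M $ k $ l) / of_int (det P))
        = (\<chi> k. det (\<chi> i j. if j = k then axis l 1 $ i else ?P $ i $ j) / det ?P)"
      by (simp add: M_def det_map_of_int[symmetric])
    then show ?thesis using cramer[of ?P] assms by (simp add: det_map_of_int)
  qed
  then have "(?P *v (\<chi> k. of_int (M $ k $ l) / of_int (det P))) $ i = (if i = l then 1 else 0)" for i l
    by (simp add: axis_def)
  then have *: "(\<Sum>k\<in>UNIV. of_int (P $ i $ k) * of_int (M $ k $ l)) / real_of_int (det P) = (if i = l then 1 else 0)"
    for i l
    by (simp add: matrix_vector_mult_def sum_divide_distrib)
  have "(\<Sum>k\<in>UNIV. real_of_int (P $ i $ k) * of_int (M $ k $ l)) = (if i = l then of_int (det P) else 0)"
    for i l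
    using *[of i l] assms by (cases "i = l") (simp_all add: divide_eq_eq)
  then show ?thesis
    by (intro exI[of _ M]) (simp add: vec_eq_iff matrix_matrix_mult_def mat_def)
qed

text \<open>The intertwining relation extends to the characteristic matrices over the polynomial
  ring; taking determinants, the nonzero constant \<open>det P\<close> cancels.\<close>

lemma charpoly_intertwine:
  fixes A B P :: "real ^ 'n::finite ^ 'n"
  assumes "P ** A = B ** P" "det P \<noteq> 0"
  shows "charpoly A = charpoly B"
proof -
  let ?x = "\<lambda>A::real^'n^'n. \<chi> i j. (if i = j then [:0, 1:] else 0) - [:A $ i $ j:]"
  let ?P = "(\<chi> i j. [:P $ i $ j:]) :: real poly ^ 'n ^ 'n"
  have "?P ** ?x A = ?x B ** ?P"
  proof -
    have "(?P ** ?x A) $ i $ j = [:0, 1:] * [:P $ i $ j:] - [:(P ** A) $ i $ j:]" for i j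
    proof -
      have "(?P ** ?x A) $ i $ j
          = (\<Sum>k\<in>UNIV. (if k = j then [:0, 1:] * [:P $ i $ k:] else 0) - [:P $ i $ k * A $ k $ j:])"
        unfolding matrix_matrix_mult_def by (auto simp: smult_diff_right intro!: sum.cong)
      then show ?thesis
        by (simp add: sum_subtractf sum_to_poly matrix_matrix_mult_def)
    qed
    moreover have "(?x B ** ?P) $ i $ j = [:0, 1:] * [:P $ i $ j:] - [:(B ** P) $ i $ j:]" for i j
    proof -
      have "(?x B ** ?P) $ i $ j
          = (\<Sum>k\<in>UNIV. (if i = k then [:0, 1:] * [:P $ k $ j:] else 0) - [:B $ i $ k * P $ k $ j:])"
        unfolding matrix_matrix_mult_def by (auto simp: smult_diff_right intro!: sum.cong)
      then show ?thesis
        by (simp add: sum_subtractf sum_to_poly matrix_matrix_mult_def)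
    qed
    ultimately show ?thesis using assms(1) by (simp add: vec_eq_iff)
  qed
  then have "det (?P ** ?x A) = det (?x B ** ?P)" by (rule arg_cong)
  then have "det ?P * charpoly A = charpoly B * det ?P"
    unfolding charpoly_def det_mul .
  moreover have "det ?P \<noteq> 0"
  proof -
    have "poly (det ?P) 0 = det P"
      by (simp add: det_def poly_sum poly_prod)
    then show ?thesis using assms(2) by auto
  qed
  ultimately show ?thesis by simp
qed

lemma charpoly_diagonal:
  fixes D :: "real ^ 'n::finite ^ 'n"
  assumes "\<And>i j. i \<noteq> j \<Longrightarrow> D $ i $ j = 0"
  shows "charpoly D = (\<Prod>j\<in>UNIV. [:- D $ j $ j, 1:])"
  unfolding charpoly_def using assms by (subst det_diagonal) auto

text \<open>Both sides are the multiset of roots of the same polynomial. This matches the ordered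
  eigenvalues with the diagonal entries, including multiplicities.\<close>

lemma image_mset_eq_of_linear_prod:
  fixes f :: "'a \<Rightarrow> 'c::idom" and g :: "'b \<Rightarrow> 'c"
  assumes "(\<Prod>k\<in>A. [:- f k, 1:]) = (\<Prod>j\<in>B. [:- g j, 1:])"
  shows "image_mset f (mset_set A) = image_mset g (mset_set B)"
proof -
  have "proots (\<Prod>k\<in>A. [:- f k, 1:]) = image_mset f (mset_set A)" for f :: "'z \<Rightarrow> 'c" and A
    by (subst proots_prod) (auto simp: sum_unfold_sum_mset)
  then show ?thesis using assms by metis
qed

text \<open>For \<open>l \<ge> 0\<close> the numerators agree term by term. For negative
  \<open>l\<close> every term of \<open>R\<close> is \<open>ln (\<beta> i) + l\<close>, while a term
  of \<open>theta\<close> with \<open>k \<le> i\<close> may be as large as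
  \<open>ln (\<beta> i)\<close>; equality persists at \<open>i = 1\<close>, where the minimum is
  then found.\<close>

lemma theta_eq_or_ge:
  fixes \<beta> :: "nat \<Rightarrow> real"
  assumes i: "i \<in> {1..d}" and \<beta>: "\<And>k. k \<in> {1..d} \<Longrightarrow> 1 < \<beta> k" and mono: "mono_on {1..d} \<beta>"
    and l: "0 < l + ln (\<beta> i)"
  defines "R \<equiv> \<Sum>k = 1..d. min (ln (\<beta> i) + l) (max (ln (\<beta> i)) (ln (\<beta> k)))"
  shows "R / (ln (\<beta> i) + l) \<le> theta d \<beta> (ereal l) i"
    and "0 \<le> l \<or> i = 1 \<Longrightarrow> theta d \<beta> (ereal l) i = R / (ln (\<beta> i) + l)"
proof -
  let ?b = "\<lambda>k. ln (\<beta> k)"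
  define h where "h k = (if k \<le> i then ?b i else ?b k) - (if ?b i + l < ?b k then ?b k - ?b i - l else 0)" for k
  have pos: "0 < \<beta> k" if "k \<in> {1..d}" for k using \<beta>[OF that] by simp
  have exp_iff: "\<beta> i * exp l < \<beta> k \<longleftrightarrow> ?b i + l < ?b k" if "k \<in> {1..d}" for k
  proof -
    have "\<beta> i * exp l = exp (?b i + l)" using pos[OF i] by (simp add: exp_add)
    then show ?thesis using pos[OF that] by (metis exp_less_cancel_iff exp_ln)
  qed
  have mono': "?b k \<le> ?b k'" if "k \<in> {1..d}" "k' \<in> {1..d}" "k \<le> k'" for k k'
    using mono_onD[OF mono that] pos that by simp
  have "(\<Sum>k | k \<in> {1..d} \<and> \<beta> k > \<beta> i * exp l. ?b k - ?b i - l)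
      = (\<Sum>k = 1..d. if ?b i + l < ?b k then ?b k - ?b i - l else 0)"
    using exp_iff by (subst sum.inter_filter[symmetric]) (auto intro!: sum.cong)
  moreover have "real i * ?b i + (\<Sum>k = i + 1..d. ?b k) = (\<Sum>k = 1..d. if k \<le> i then ?b i else ?b k)"
  proof -
    have "{1..d} = {1..i} \<union> {i + 1..d}" "{1..i} \<inter> {i + 1..d} = {}" using i by auto
    then have "(\<Sum>k = 1..d. if k \<le> i then ?b i else ?b k)
       = (\<Sum>k = 1..i. if k \<le> i then ?b i else ?b k) + (\<Sum>k = i + 1..d. if k \<le> i then ?b i else ?b k)"
      by (simp add: sum.union_disjoint)
    also have "(\<Sum>k = 1..i. if k \<le> i then ?b i else ?b k) = real i * ?b i" by simp
    also have "(\<Sum>k = i + 1..d. if k \<le> i then ?b i else ?b k) = (\<Sum>k = i + 1..d. ?b k)"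
      by (intro sum.cong) auto
    finally show ?thesis by simp
  qed
  ultimately have theta: "theta d \<beta> (ereal l) i = (\<Sum>k = 1..d. h k) / (?b i + l)"
    by (simp add: theta_def Let_def h_def sum_subtractf algebra_simps)
  have h_ge: "min (?b i + l) (max (?b i) (?b k)) \<le> h k" if "k \<in> {1..d}" for k
    using mono'[of k i] mono'[of i k] i that by (auto simp: h_def)
  have h_eq: "min (?b i + l) (max (?b i) (?b k)) = h k" if "k \<in> {1..d}" "0 \<le> l \<or> i = 1" for k
    using mono'[of k i] mono'[of i k] i that by (auto simp: h_def)
  show "R / (?b i + l) \<le> theta d \<beta> (ereal l) i"
    unfolding theta R_def using h_ge l by (intro divide_right_mono sum_mono) auto
  show "theta d \<beta> (ereal l) i = R / (?b i + l)" if "0 \<le> l \<or> i = 1"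
    unfolding theta R_def using h_eq that by simp
qed

lemma continuous_rate_quotient:
  assumes "v + l \<noteq> 0"
  shows "isCont (\<lambda>L. rate b L v / (v + L)) l"
  unfolding rate_def using assms by (intro continuous_intros) auto

section \<open>From the lower order to comparisons with exponential radii\<close>

lemma lower_order_less_imp_infinite:
  assumes "lower_order \<psi> < ereal L" and pos: "\<And>x. 0 < x \<Longrightarrow> 0 < \<psi> x"
  shows "infinite {n. exp (- real n * L) \<le> \<psi> (real n)}"
proof
  assume fin: "finite {n. exp (- real n * L) \<le> \<psi> (real n)}"
  then have "\<forall>\<^sub>F n in sequentially. \<not> exp (- real n * L) \<le> \<psi> (real n)"
    by (simp add: cofinite_eq_sequentially[symmetric] eventually_cofinite)
  \<comment> \<open>The index 0 is discarded: \<open>\<psi> 0\<close> may fail to be positive, and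
    the quotient needs \<open>n > 0\<close>.\<close>
  then have "\<forall>\<^sub>F n in sequentially. ereal L \<le> ereal (- ln (\<psi> (real n)) / real n)"
    using eventually_gt_at_top[of 0]
  proof eventually_elim
    case (elim n)
    then have "0 < \<psi> (real n)" using pos by simp
    then have "ln (\<psi> (real n)) \<le> - real n * L"
      using elim by (metis ln_exp ln_le_cancel_iff exp_gt_zero less_imp_le not_le)
    then show ?case using elim(2) by (simp add: field_simps)
  qed
  then have "ereal L \<le> lower_order \<psi>" unfolding lower_order_def by (rule Liminf_bounded)
  then show False using assms(1) by simp
qed

lemma less_lower_order_imp_eventually:
  assumes "ereal L < lower_order \<psi>" and pos: "\<And>x. 0 < x \<Longrightarrow> 0 < \<psi> x"
  shows "\<forall>\<^sub>F n in sequentially. \<psi> (real n) \<le> exp (- real n * L)"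
proof -
  have "\<forall>\<^sub>F n in sequentially. ereal L < ereal (- ln (\<psi> (real n)) / real n)"
    using assms(1) unfolding lower_order_def by (rule less_LiminfD)
  then show ?thesis using eventually_gt_at_top[of 0]
  proof eventually_elim
    case (elim n)
    then have "0 < \<psi> (real n)" using pos by simp
    have "ln (\<psi> (real n)) \<le> - real n * L" using elim by (simp add: field_simps)
    then have "exp (ln (\<psi> (real n))) \<le> exp (- real n * L)" by simp
    then show ?case using \<open>0 < \<psi> (real n)\<close> by simp
  qed
qed

lemma shrinking_target_subset:
  assumes "ereal L < lower_order \<psi>" and pos: "\<And>x. 0 < x \<Longrightarrow> 0 < \<psi> x"
  shows "shrinking_target_set T \<psi> a \<subseteq> {x. \<exists>\<^sub>\<infinity>n. (torus_map T ^^ n) x \<in> cball a (exp (- real n * L))}"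
proof
  fix x assume "x \<in> shrinking_target_set T \<psi> a"
  then have "\<exists>\<^sub>\<infinity>n. (torus_map T ^^ n) x \<in> cball a (\<psi> (real n))" by (simp add: shrinking_target_set_def)
  moreover have "\<forall>\<^sub>\<infinity>n. \<psi> (real n) \<le> exp (- real n * L)"
    using less_lower_order_imp_eventually[OF assms] by (simp add: cofinite_eq_sequentially)
  ultimately have "\<exists>\<^sub>\<infinity>n. (torus_map T ^^ n) x \<in> cball a (\<psi> (real n)) \<and> \<psi> (real n) \<le> exp (- real n * L)"
    by (rule INFM_conjI)
  then have "\<exists>\<^sub>\<infinity>n. (torus_map T ^^ n) x \<in> cball a (exp (- real n * L))"
    by (rule INFM_mono) auto
  then show "x \<in> {x. \<exists>\<^sub>\<infinity>n. (torus_map T ^^ n) x \<in> cball a (exp (- real n * L))}" by simp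
qed

section \<open>The dimension formula, by approximating the lower order from either side\<close>

theorem theorem8:
  fixes T :: "int ^ 'n ^ 'n"
    and \<beta> :: "nat \<Rightarrow> real"
    and \<psi> :: "real \<Rightarrow> real"
    and a :: "'n torus"
  assumes "det T \<noteq> 0"
    and "diagonalizable_over_int T"
    and "charpoly (map_matrix real_of_int T) = (\<Prod>k = 1..CARD('n). [:- \<beta> k, 1:])"
    and "\<forall>k\<in>{1..CARD('n)}. 1 < \<beta> k"
    and "mono_on {1..CARD('n)} \<beta>"
    and "\<forall>x>0. 0 < \<psi> x"
    and "ereal (- ln (\<beta> 1)) < lower_order \<psi>"
  shows "hausdorff_dim (shrinking_target_set T \<psi> a)
    = ereal (MIN i\<in>{1..CARD('n)}. theta CARD('n) \<beta> (lower_order \<psi>) i)"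
proof -
  let ?I = "{1..CARD('n)}" and ?W = "shrinking_target_set T \<psi> a"
  have \<psi>: "0 < x \<Longrightarrow> 0 < \<psi> x" for x using assms(6) by blast
  have one: "1 \<in> ?I" using zero_less_card_finite[where 'a='n] by simp
  obtain P D :: "int^'n^'n" where P: "det P \<noteq> 0" and D: "\<And>i j. i \<noteq> j \<Longrightarrow> D $ i $ j = 0"
    and PTD: "P ** T = D ** P"
    using assms(2) unfolding diagonalizable_over_int_def by blast
  let ?P = "map_matrix real_of_int P" and ?T = "map_matrix real_of_int T" and ?D = "map_matrix real_of_int D"
  define \<delta> where "\<delta> j = real_of_int (D $ j $ j)" for j
  have PT: "?P ** ?T = ?D ** ?P" using PTD by (simp add: of_int_matrix_mult[symmetric])
  have detP: "det ?P \<noteq> 0" using P by (simp add: det_map_of_int)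
  have "(\<Prod>k\<in>?I. [:- \<beta> k, 1:]) = (\<Prod>j\<in>UNIV. [:- \<delta> j, 1:])"
    using charpoly_intertwine[OF PT detP] charpoly_diagonal[of ?D] D assms(3) by (simp add: \<delta>_def)
  then have ms: "image_mset \<beta> (mset_set ?I) = image_mset \<delta> (mset_set UNIV)"
    by (rule image_mset_eq_of_linear_prod)
  have range: "\<beta> ` ?I = range \<delta>" using arg_cong[OF ms, of set_mset] by simp
  have sums: "(\<Sum>k\<in>?I. h (\<beta> k)) = (\<Sum>j\<in>UNIV. h (\<delta> j))" for h :: "real \<Rightarrow> real"
    using arg_cong[OF ms, of "\<lambda>m. sum_mset (image_mset h m)"]
    by (simp add: sum_unfold_sum_mset image_mset.compositionality comp_def)
  have \<beta>: "1 < \<beta> k" "\<beta> 1 \<le> \<beta> k" if "k \<in> ?I" for k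
    using assms(4) mono_onD[OF assms(5) one that] that by auto
  have \<delta>_ge: "1 < \<delta> j" "\<beta> 1 \<le> \<delta> j" for j
  proof -
    obtain k where "k \<in> ?I" "\<delta> j = \<beta> k" using range by (metis imageE rangeI)
    then show "1 < \<delta> j" "\<beta> 1 \<le> \<delta> j" using \<beta> by auto
  qed
  obtain M where PM: "?P ** map_matrix real_of_int M = mat (of_int (det P))"
    using integer_adjugate[OF P] by blast
  let ?M = "map_matrix real_of_int M"
  have PM': "?P *v (?M *v x) = of_int (det P) *\<^sub>R x" for x
    unfolding matrix_vector_mul_assoc PM
    by (simp add: vec_eq_iff matrix_vector_mult_def mat_def if_distrib[of "\<lambda>z. z * _"] cong: if_cong)
  \<comment> \<open>From \<open>P M P = det P * P\<close> and the injectivity of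
    \<open>P\<close>.\<close>
  have MP': "?M *v (?P *v x) = of_int (det P) *\<^sub>R x" for x
  proof -
    have "?P *v (?M *v (?P *v x)) = ?P *v (of_int (det P) *\<^sub>R x)"
      unfolding PM' by (simp add: matrix_vector_mult_scaleR)
    moreover have "inj ((*v) ?P)" using detP by (simp add: invertible_det_nz inj_matrix_vector_mult)
    ultimately show ?thesis by (rule injD[rotated])
  qed
  interpret int_diagonalization T P M "det P" \<delta>
  proof
    show "(?P *v (?T *v x)) $ k = \<delta> k * (?P *v x) $ k" for x k
    proof -
      have "(?D *v z) $ k = (\<Sum>j\<in>UNIV. if j = k then \<delta> k * z $ k else 0)" for z
        unfolding matrix_vector_mult_def vec_lambda_beta
        by (rule sum.cong[OF refl]) (simp add: \<delta>_def D)
      then have "(?D *v z) $ k = \<delta> k * z $ k" for z by simp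
      moreover have "?P *v (?T *v x) = ?D *v (?P *v x)" by (simp only: matrix_vector_mul_assoc PT)
      ultimately show ?thesis by simp
    qed
  qed (fact PM' MP' P \<delta>_ge(1))+
  have b_ge: "ln (\<beta> 1) \<le> b k" for k
    unfolding b_def using \<delta>_ge[of k] \<beta>(1)[OF one] by simp
  have rate: "(\<Sum>k = 1..CARD('n). min (v + l) (max v (ln (\<beta> k)))) = rate b l v" for v l
    unfolding rate_def b_def by (rule sums)
  have upper: "hausdorff_measure t ?W = 0"
    if "\<And>k. 0 < b k + L" "ereal L < lower_order \<psi>" "0 < t" "rate b L (b i) < t * (b i + L)" for i L t
    by (rule upper_bound[OF that(1,3,4) shrinking_target_subset[OF that(2) \<psi>]])
  show ?thesis
  proof (cases "lower_order \<psi>")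
    case PInf
    have "hausdorff_measure t ?W = 0" if "0 < t" for t
    proof -
      let ?i = "undefined :: 'n"
      \<comment> \<open>\<open>R\<close> bounds \<open>rate b L (b ?i)\<close> for all
        \<open>L\<close>, so a large enough finite \<open>L\<close> pushes the covering exponent
        below any \<open>t > 0\<close>.\<close>
      define R where "R = (\<Sum>j\<in>UNIV. max (b ?i) (b j))"
      define L where "L = R / t"
      have "0 \<le> R" unfolding R_def using b_pos by (intro sum_nonneg) (simp add: le_max_iff_disj less_imp_le)
      then have L: "0 \<le> L" using that by (simp add: L_def)
      have "rate b L (b ?i) \<le> R" unfolding rate_def R_def by (intro sum_mono) simp
      also have "R = t * L" using that by (simp add: L_def)
      also have "\<dots> < t * (b ?i + L)" using that b_pos by simp
      finally show ?thesis
        using that L b_pos by (intro upper[of L t ?i]) (auto simp: PInf intro: add_pos_nonneg)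
    qed
    then have "hausdorff_dim ?W \<le> ereal 0" by (intro hausdorff_dim_leI) auto
    then have "hausdorff_dim ?W = 0" using hausdorff_dim_nonneg[of ?W] by (simp add: zero_ereal_def antisym)
    moreover have "(\<lambda>i. theta CARD('n) \<beta> (lower_order \<psi>) i) ` ?I = {0}"
      unfolding theta_def PInf using image_constant[OF one] by (simp only: refl if_True)
    ultimately show ?thesis by (simp add: zero_ereal_def)
  next
    case (real l)
    have l: "- ln (\<beta> 1) < l" using assms(7) real by simp
    have bl: "0 < b k + l" for k using b_ge[of k] l by linarith
    have theta_ge: "rate b l (ln (\<beta> i)) / (ln (\<beta> i) + l) \<le> theta CARD('n) \<beta> l i"
      and theta_eq: "0 \<le> l \<or> i = 1 \<Longrightarrow> theta CARD('n) \<beta> l i = rate b l (ln (\<beta> i)) / (ln (\<beta> i) + l)"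
      if "i \<in> ?I" for i
    proof -
      have "ln (\<beta> 1) \<le> ln (\<beta> i)" using \<beta>[OF that] \<beta>(1)[OF one] by simp
      then have "0 < l + ln (\<beta> i)" using l by linarith
      from theta_eq_or_ge[OF that \<beta>(1) assms(5) this]
      show "rate b l (ln (\<beta> i)) / (ln (\<beta> i) + l) \<le> theta CARD('n) \<beta> l i"
        "0 \<le> l \<or> i = 1 \<Longrightarrow> theta CARD('n) \<beta> l i = rate b l (ln (\<beta> i)) / (ln (\<beta> i) + l)"
        unfolding rate by blast+
    qed
    have to_b: "\<exists>j. b j = ln (\<beta> i)" if "i \<in> ?I" for i
      using range that unfolding b_def by (metis imageI rangeE)
    have of_b: "\<exists>i\<in>?I. b j = ln (\<beta> i)" for j
      using range unfolding b_def by (metis imageE rangeI)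
    have le: "hausdorff_dim ?W \<le> ereal (theta CARD('n) \<beta> l i)" if i: "i \<in> ?I" for i
    proof -
      obtain j where j: "b j = ln (\<beta> i)" using to_b[OF i] by blast
      have "hausdorff_dim ?W \<le> ereal (rate b l (b j) / (b j + l))"
      proof (rule hausdorff_dim_leI)
        show nonneg: "0 \<le> rate b l (b j) / (b j + l)"
          unfolding rate_def using bl[of j] b_pos[of j]
          by (intro divide_nonneg_pos sum_nonneg) (auto simp: le_max_iff_disj)
        fix t assume t: "rate b l (b j) / (b j + l) < t"
        \<comment> \<open>Targets are eventually inside balls of radius \<open>exp (- n * L)\<close>
          only for \<open>L < l\<close>, so the bound is applied slightly left of \<open>l\<close>
          and continuity closes the gap.\<close>
        have "((\<lambda>L. rate b L (b j) / (b j + L)) \<longlongrightarrow> rate b l (b j) / (b j + l)) (at_left l)"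
          using continuous_rate_quotient[of "b j" l b] bl[of j]
          unfolding isCont_def by (auto intro: filterlim_mono at_le)
        from order_tendstoD(2)[OF this t] eventually_at_left_real[OF l]
        have "\<forall>\<^sub>F L in at_left l. rate b L (b j) / (b j + L) < t \<and> L \<in> {- ln (\<beta> 1)<..<l}"
          by (rule eventually_conj)
        from eventually_happens'[OF trivial_limit_at_left_real this]
        obtain L where L: "rate b L (b j) / (b j + L) < t" "- ln (\<beta> 1) < L" "L < l" by auto
        have bL: "0 < b k + L" for k using b_ge[of k] L(2) by linarith
        show "hausdorff_measure t ?W = 0"
          using L(1,3) bL nonneg t by (intro upper[of L t j]) (auto simp: real pos_divide_less_eq)
      qed
      also have "\<dots> \<le> ereal (theta CARD('n) \<beta> l i)" using theta_ge[OF i] j by simp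
      finally show ?thesis .
    qed
    have ge: "ereal (MIN i\<in>?I. theta CARD('n) \<beta> l i) \<le> hausdorff_dim ?W"
    proof (rule hausdorff_dim_geI)
      fix t assume t: "0 < t" "t < (MIN i\<in>?I. theta CARD('n) \<beta> l i)"
      then have t_less: "t < theta CARD('n) \<beta> l i" if "i \<in> ?I" for i
        using that Min_le[of "theta CARD('n) \<beta> l ` ?I" "theta CARD('n) \<beta> l i"] by force
      \<comment> \<open>Infinitely many targets contain such balls once \<open>L > l\<close>. For
        \<open>l \<ge> 0\<close> take \<open>L\<close> slightly above \<open>l\<close>; for negative
        \<open>l\<close> take \<open>L = 0\<close>, where \<open>rate b 0 v = CARD('n) * v\<close>
        and the full dimension is obtained.\<close>
      have "\<exists>L. 0 \<le> L \<and> l < L \<and> (\<forall>j. t * (b j + L) < rate b L (b j))"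
      proof (cases "0 \<le> l")
        case True
        have "\<forall>\<^sub>F L in at_right l. t < rate b L (b j) / (b j + L)" for j
        proof -
          obtain i where i: "i \<in> ?I" "b j = ln (\<beta> i)" using of_b by blast
          have "t < rate b l (b j) / (b j + l)" using t_less[OF i(1)] theta_eq[OF i(1)] True i(2) by simp
          moreover have "((\<lambda>L. rate b L (b j) / (b j + L)) \<longlongrightarrow> rate b l (b j) / (b j + l)) (at_right l)"
            using continuous_rate_quotient[of "b j" l b] bl[of j]
            unfolding isCont_def by (auto intro: filterlim_mono at_le)
          ultimately show ?thesis using order_tendstoD(1) by blast
        qed
        then have "\<forall>\<^sub>F L in at_right l. \<forall>j. t < rate b L (b j) / (b j + L)"
          by (rule eventually_all_finite)
        from eventually_happens'[OF trivial_limit_at_right_real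
            eventually_conj[OF this eventually_at_right_less[of l]]]
        obtain L where L: "\<forall>j. t < rate b L (b j) / (b j + L)" "l < L" by blast
        have "0 < b j + L" for j using b_pos[of j] True L(2) by linarith
        then show ?thesis using L True by (intro exI[of _ L]) (auto simp: pos_less_divide_eq)
      next
        case False
        have "theta CARD('n) \<beta> l 1 \<le> real CARD('n)"
        proof -
          obtain j where "b j = ln (\<beta> 1)" using to_b[OF one] by blast
          then show ?thesis
            using theta_eq[OF one] rate_le[of b l "b j"] bl[of j] by (simp add: pos_divide_le_eq)
        qed
        then have "t < real CARD('n)" using t_less[OF one] by linarith
        then have "t * (b j + 0) < rate b 0 (b j)" for j
          using b_pos[of j] by (simp add: rate_def)
        then show ?thesis using False by (intro exI[of _ 0]) auto
      qed
      then obtain L where L: "0 \<le> L" "l < L" "\<And>j. t * (b j + L) < rate b L (b j)" by blast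
      have "infinite {n. exp (- real n * L) \<le> \<psi> (real n)}"
        using L(2) real by (intro lower_order_less_imp_infinite \<psi>) auto
      from lower_bound[OF L(1) t(1) L(3) this, of "\<lambda>n. \<psi> (real n)" a]
      show "hausdorff_measure t ?W \<noteq> 0" unfolding shrinking_target_set_def by blast
    qed
    have "(MIN i\<in>?I. theta CARD('n) \<beta> l i) \<in> theta CARD('n) \<beta> l ` ?I"
      using one by (intro Min_in) auto
    then obtain i where "i \<in> ?I" "(MIN i\<in>?I. theta CARD('n) \<beta> l i) = theta CARD('n) \<beta> l i" by blast
    then show ?thesis using le[of i] ge unfolding real by (simp add: antisym)
  next
    case MInf
    then show ?thesis using assms(7) by simp
  qed
qed

end
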